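(* Let $n,m\ge 1$, let $k_1,\dots,k_J$ be positive integers, and let $r=k_1+\cdots+k_J$ with $r\le\min(n,m)$. The set of all real $n\times m$ matrices $A$ having exactly $J$ distinct (positive) singular values $\sigma_1>\sigma_2>\cdots>\sigma_J>0$ (of arbitrary values), with respective multiplicities $k_1,\dots,k_J$, has real dimension $$(n+m-r)r-r-\frac12\sum_{j=1}^J k_j(k_j-1)+J .$$
   Context: $R^{nm}$ denotes the space of real $n\times m$ matrices. Every $A\in R^{nm}$ has a singular value decomposition $A=U\Sigma V^T$ with $U$ ($n\times n$) and $V$ ($m\times m$) real orthogonal and $\Sigma\in R^{nm}$ zero except for $r\le\min(n,m)$ positive entries on the main diagonal starting at the upper left corner. Only these positive entries are called singular values of $A$, so $r$ is the rank of $A$. "Real dimension" of a subset of $R^{nm}$ is the usual dimension over $\mathbb R$ (of a real manifold, or of a semialgebraic set). *)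

theory Defs
  imports "HOL-Analysis.Analysis" "HOL-Library.Multiset"
begin

text \<open>Matrices of type \<^typ>\<open>real^'m^'n\<close> are indexed by arbitrary finite types, so ``main diagonal''
  needs a numbering of the indices. \<^term>\<open>to_nat_on UNIV\<close> is a bijection from a finite type onto
  \<open>{0..<CARD('n)}\<close> (see \<open>to_nat_on_finite\<close>). The choice of the numbering is
  irrelevant for singular values, since permutation matrices are orthogonal.\<close>

definition idx :: "'n::finite \<Rightarrow> nat" where
  "idx = to_nat_on (UNIV :: 'n set)"

definition diag_mat :: "real list \<Rightarrow> real^'m^'n" where
  "diag_mat s = (\<chi> i j. if idx i = idx j \<and> idx i < length s then s ! idx i else 0)"

definition is_svd :: "real^'m^'n \<Rightarrow> real^'n^'n \<Rightarrow> real list \<Rightarrow> real^'m^'m \<Rightarrow> bool" where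
  "is_svd A U s V \<longleftrightarrow>
     orthogonal_matrix U \<and> orthogonal_matrix V \<and>
     length s \<le> min CARD('n) CARD('m) \<and> (\<forall>x\<in>set s. 0 < x) \<and>
     A = U ** diag_mat s ** transpose V"

text \<open>\<open>M\<close> is the multiset of (positive) singular values of \<open>A\<close>, counted with multiplicity.
  It exists and does not depend on the chosen decomposition.\<close>

definition has_singular_values :: "real^'m^'n \<Rightarrow> real multiset \<Rightarrow> bool" where
  "has_singular_values A M \<longleftrightarrow> (\<exists>U s V. is_svd A U s V \<and> M = mset s)"

definition singular_stratum :: "nat \<Rightarrow> (nat \<Rightarrow> nat) \<Rightarrow> (real^'m^'n) set" where
  "singular_stratum J k =
     {A. \<exists>\<sigma> :: nat \<Rightarrow> real.
           (\<forall>i\<in>{1..J}. \<forall>j\<in>{1..J}. i < j \<longrightarrow> \<sigma> i > \<sigma> j) \<and>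
           (\<forall>j\<in>{1..J}. \<sigma> j > 0) \<and>
           has_singular_values A (\<Sum>j=1..J. replicate_mset (k j) (\<sigma> j))}"

definition C1_on :: "'a::euclidean_space set \<Rightarrow> ('a \<Rightarrow> 'a) \<Rightarrow> bool" where
  "C1_on U f \<longleftrightarrow>
     (\<exists>f' :: 'a \<Rightarrow> 'a \<Rightarrow>\<^sub>L 'a.
        (\<forall>x\<in>U. (f has_derivative blinfun_apply (f' x)) (at x)) \<and> continuous_on U f')"

text \<open>Embedded submanifolds, by local straightening: some \<open>C\<^sup>1\<close> diffeomorphism between open sets
  of the ambient space carries the set to a \<open>d\<close>-dimensional linear subspace. Being closed in the
  ambient space is not required.\<close>

definition C1_submanifold :: "nat \<Rightarrow> 'a::euclidean_space set \<Rightarrow> bool" where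
  "C1_submanifold d M \<longleftrightarrow>
     (\<forall>x\<in>M. \<exists>U V \<phi> \<psi> L.
        open U \<and> open V \<and> x \<in> U \<and>
        homeomorphism U V \<phi> \<psi> \<and> C1_on U \<phi> \<and> C1_on V \<psi> \<and>
        subspace L \<and> dim L = d \<and> \<phi> ` (M \<inter> U) = L \<inter> V)"

text \<open>The dimension of a subset of a Euclidean space: the largest dimension of a nonempty \<open>C\<^sup>1\<close>
  submanifold contained in it. For a \<open>d\<close>-dimensional submanifold this is \<open>d\<close>, and for
  a semialgebraic set it is its dimension as a semialgebraic set (the largest dimension of a cell
  in a cell decomposition). The maximum exists for every nonempty \<open>S\<close>; the value for the empty set is
  unspecified.\<close>

definition real_dim :: "'a::euclidean_space set \<Rightarrow> nat" where
  "real_dim S = (GREATEST d. \<exists>M. M \<noteq> {} \<and> M \<subseteq> S \<and> C1_submanifold d M)"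

end

theory Submission
  imports Defs
begin

text \<open>Let \<open>D = diag_mat s\<close> lie in the stratum and let \<open>T\<close> be the space of all \<open>X\<close> whose block outside the first \<open>r\<close>
  rows and columns vanishes and whose diagonal block at each repeated singular value is a scalar plus a
  skew matrix. Counting free coordinates, \<open>dim T\<close> is the claimed number.

  Lower bound: solving \<open>K D + N - D L = X\<close> linearly in \<open>X\<close> with \<open>K\<close>, \<open>L\<close> skew and \<open>N\<close> normal to the orbit,
  the map \<open>X \<mapsto> cay (K/2) (D + N) cay (L/2)\<^sup>T\<close> has derivative \<open>1\<close> at \<open>0\<close> and sends a neighbourhood of \<open>0\<close> in \<open>T\<close>
  into the stratum, so its image is a submanifold by the inverse function theorem.

  Upper bound: every tangent vector at \<open>D\<close> of a submanifold of the stratum lies in \<open>T\<close>. Take matrices \<open>A i\<close> in the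
  stratum with difference quotients tending to \<open>X\<close>. By compactness of the orthogonal groups their singular
  vectors converge along a subsequence, and since the number of distinct singular values is constant, every
  eigenvector of \<open>D D\<^sup>T\<close> is a limit of eigenvectors of \<open>A i (A i)\<^sup>T\<close>. Comparing the two eigenvalue equations and
  dividing by the step gives the linear conditions defining \<open>T\<close>.\<close>

section \<open>Continuously differentiable maps\<close>

text \<open>Continuity is asked only of \<open>f' x h\<close> for each fixed \<open>h\<close>. In
  finite dimension this amounts to continuity of the derivative in operator norm, and it passes
  directly through sums, products and quotients.\<close>

definition C1_real :: "('a::euclidean_space \<Rightarrow> real) \<Rightarrow> bool" where
  "C1_real f \<longleftrightarrow>
     (\<exists>f'. (\<forall>x. (f has_derivative f' x) (at x)) \<and> (\<forall>h. continuous_on UNIV (\<lambda>x. f' x h)))"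

lemma C1_real_continuous: "C1_real f \<Longrightarrow> continuous_on UNIV f"
  unfolding C1_real_def
  by (auto intro!: continuous_at_imp_continuous_on dest: has_derivative_continuous)

lemma C1_real_const: "C1_real (\<lambda>x. c)"
  unfolding C1_real_def by (rule exI[of _ "\<lambda>x h. 0"]) auto

lemma C1_real_linear: "bounded_linear f \<Longrightarrow> C1_real f"
  unfolding C1_real_def
  by (rule exI[of _ "\<lambda>x. f"]) (auto intro: bounded_linear_imp_has_derivative)

lemma C1_real_add:
  assumes "C1_real f" "C1_real g" shows "C1_real (\<lambda>x. f x + g x)"
proof -
  obtain f' g' where "\<And>x. (f has_derivative f' x) (at x)" "\<And>h. continuous_on UNIV (\<lambda>x. f' x h)"
    "\<And>x. (g has_derivative g' x) (at x)" "\<And>h. continuous_on UNIV (\<lambda>x. g' x h)"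
    using assms unfolding C1_real_def by blast
  then show ?thesis
    unfolding C1_real_def
    by (intro exI[of _ "\<lambda>x h. f' x h + g' x h"])
      (auto intro!: has_derivative_add continuous_on_add)
qed

lemma C1_real_mult:
  assumes "C1_real f" "C1_real g" shows "C1_real (\<lambda>x. f x * g x)"
proof -
  obtain f' g' where "\<And>x. (f has_derivative f' x) (at x)" "\<And>h. continuous_on UNIV (\<lambda>x. f' x h)"
    "\<And>x. (g has_derivative g' x) (at x)" "\<And>h. continuous_on UNIV (\<lambda>x. g' x h)"
    using assms unfolding C1_real_def by blast
  then show ?thesis
    using C1_real_continuous[OF assms(1)] C1_real_continuous[OF assms(2)]
    unfolding C1_real_def
    by (intro exI[of _ "\<lambda>x h. f x * g' x h + f' x h * g x"])
      (auto intro!: has_derivative_mult continuous_intros)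
qed

lemma C1_real_inverse:
  assumes "C1_real f" "\<And>x. f x \<noteq> 0" shows "C1_real (\<lambda>x. inverse (f x))"
proof -
  obtain f' where "\<And>x. (f has_derivative f' x) (at x)" "\<And>h. continuous_on UNIV (\<lambda>x. f' x h)"
    using assms unfolding C1_real_def by blast
  then show ?thesis
    using C1_real_continuous[OF assms(1)] assms(2)
    unfolding C1_real_def
    by (intro exI[of _ "\<lambda>x h. - (inverse (f x) * f' x h * inverse (f x))"])
      (auto intro!: has_derivative_inverse continuous_intros)
qed

lemma C1_real_divide:
  "C1_real f \<Longrightarrow> C1_real g \<Longrightarrow> (\<And>x. g x \<noteq> 0) \<Longrightarrow> C1_real (\<lambda>x. f x / g x)"
  unfolding divide_inverse by (intro C1_real_mult C1_real_inverse)

lemma C1_real_sum: "(\<And>i. i \<in> I \<Longrightarrow> C1_real (f i)) \<Longrightarrow> C1_real (\<lambda>x. \<Sum>i\<in>I. f i x)"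
  by (induction I rule: infinite_finite_induct) (simp_all add: C1_real_const C1_real_add)

lemma C1_real_prod: "(\<And>i. i \<in> I \<Longrightarrow> C1_real (f i)) \<Longrightarrow> C1_real (\<lambda>x. \<Prod>i\<in>I. f i x)"
  by (induction I rule: infinite_finite_induct) (simp_all add: C1_real_const C1_real_mult)

lemma C1_real_det:
  fixes A :: "'a::euclidean_space \<Rightarrow> real^'n^'n"
  assumes "\<And>i j. C1_real (\<lambda>x. A x $ i $ j)"
  shows "C1_real (\<lambda>x. det (A x))"
  unfolding det_def by (intro C1_real_sum C1_real_mult C1_real_const C1_real_prod assms)

text \<open>In finite dimension, continuity of \<open>f' x h\<close> for every \<open>h\<close>
  implies continuity of \<open>f'\<close> in operator norm. This is the bridge from
  \<open>C1_real\<close> to \<open>C1_on\<close>.\<close>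

lemma C1_on_componentwise:
  fixes f :: "'a::euclidean_space \<Rightarrow> 'a"
  assumes "\<And>b. b \<in> Basis \<Longrightarrow> C1_real (\<lambda>x. f x \<bullet> b)"
  shows "C1_on UNIV f"
proof -
  obtain F where F: "\<And>b x. b \<in> Basis \<Longrightarrow> ((\<lambda>x. f x \<bullet> b) has_derivative F b x) (at x)"
    and cont: "\<And>b h. b \<in> Basis \<Longrightarrow> continuous_on UNIV (\<lambda>x. F b x h)"
    using assms unfolding C1_real_def by metis
  define f' where "f' x h = (\<Sum>b\<in>Basis. F b x h *\<^sub>R b)" for x h
  have der: "(f has_derivative f' x) (at x)" for x
    unfolding has_derivative_componentwise_within[of f]
  proof
    fix b :: 'a assume b: "b \<in> Basis"
    then have "f' x h \<bullet> b = F b x h" for h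
      by (simp add: f'_def inner_sum_left_Basis)
    then show "((\<lambda>x. f x \<bullet> b) has_derivative (\<lambda>h. f' x h \<bullet> b)) (at x)"
      using F[OF b] by simp
  qed
  have bl: "bounded_linear (f' x)" for x
    using der has_derivative_bounded_linear by blast
  have "continuous_on UNIV (\<lambda>x. f' x h)" for h
    unfolding f'_def by (intro continuous_intros cont)
  then have "continuous_on UNIV (\<lambda>x. Blinfun (f' x))"
    by (intro continuous_on_blinfun_componentwise) (simp add: bounded_linear_Blinfun_apply bl)
  then show ?thesis
    unfolding C1_on_def
    by (intro exI[of _ "\<lambda>x. Blinfun (f' x)"]) (simp add: bounded_linear_Blinfun_apply bl der)
qed

lemma C1_on_matrix:
  fixes f :: "real^'m^'n \<Rightarrow> real^'m^'n"
  assumes "\<And>i j. C1_real (\<lambda>x. f x $ i $ j)"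
  shows "C1_on UNIV f"
proof (rule C1_on_componentwise)
  fix b :: "real^'m^'n" assume "b \<in> Basis"
  then obtain i j where "b = axis i (axis j 1)"
    by (auto simp: Basis_vec_def)
  then show "C1_real (\<lambda>x. f x \<bullet> b)"
    using assms[of i j] by (simp add: inner_axis)
qed

text \<open>Near a point where \<open>f'\<close> is the identity, \<open>f'\<close> is invertible with inverse of norm at most \<open>2\<close>,
  so that the resolvent identity gives the continuity of the derivative of the local inverse.\<close>

lemma C1_local_inverse:
  fixes f :: "'a::euclidean_space \<Rightarrow> 'a"
  assumes "C1_on U f" "open U" "x0 \<in> U" "(f has_derivative (\<lambda>h. h)) (at x0)"
  obtains U' V g where "open U'" "U' \<subseteq> U" "x0 \<in> U'" "open V"
    "homeomorphism U' V f g" "C1_on U' f" "C1_on V g"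
proof -
  obtain f' :: "'a \<Rightarrow> 'a \<Rightarrow>\<^sub>L 'a" where
    f': "\<And>x. x \<in> U \<Longrightarrow> (f has_derivative f' x) (at x)" and cont: "continuous_on U f'"
    using assms(1) unfolding C1_on_def by blast
  have "blinfun_apply (f' x0) = (\<lambda>h. h)"
    using f'[OF assms(3)] assms(4) has_derivative_unique by blast
  then have id: "f' x0 = id_blinfun"
    by (intro blinfun_eqI) simp
  define W where "W = U \<inter> {x\<in>U. dist (f' x) (f' x0) < 1/2}"
  have "open ({x\<in>U. f' x \<in> ball (f' x0) (1/2)})"
    using continuous_open_preimage[OF cont assms(2) open_ball[of "f' x0" "1/2"]]
    by (simp add: vimage_def Int_def)
  then have W: "open W" "x0 \<in> W" "W \<subseteq> U"
    using assms(2,3) by (auto simp: W_def dist_commute)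
  have half: "norm h \<le> 2 * norm (f' x h)" if "x \<in> W" for x h
  proof -
    have "norm (f' x - id_blinfun) \<le> 1/2"
      using that id by (simp add: W_def dist_norm)
    then have "norm ((f' x - id_blinfun) h) \<le> 1/2 * norm h"
      by (meson norm_blinfun mult_right_mono norm_ge_zero order_trans)
    moreover have "norm h \<le> norm (f' x h) + norm (f' x h - h)"
      by (metis norm_minus_commute norm_triangle_sub)
    ultimately show ?thesis
      by (simp add: blinfun.diff_left)
  qed
  have "id_blinfun o\<^sub>L f' x0 = id_blinfun"
    by (intro blinfun_eqI) (simp add: id)
  then obtain U' V g g' where UV: "open U'" "U' \<subseteq> W" "x0 \<in> U'" "open V" "f x0 \<in> V"
    and hom: "homeomorphism U' V f g"
    and g': "\<And>y. y \<in> V \<Longrightarrow> (g has_derivative (g' y)) (at y)"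
      "\<And>y. y \<in> V \<Longrightarrow> g' y = inv (blinfun_apply (f' (g y)))"
      "\<And>y. y \<in> V \<Longrightarrow> bij (blinfun_apply (f' (g y)))"
    using inverse_function_theorem[OF W(1) f'[OF subsetD[OF W(3)]]
        continuous_on_subset[OF cont W(3)] W(2)] by blast
  have gW: "g y \<in> W" if "y \<in> V" for y
    using that hom UV(2) by (auto simp: homeomorphism_def)
  have fg': "f' (g y) (g' y h) = h" if "y \<in> V" for y h
    using g'(2,3)[OF that] by (simp add: bij_is_surj surj_f_inv_f)
  have bl: "bounded_linear (g' y)" if "y \<in> V" for y
    using g'(1)[OF that] has_derivative_bounded_linear by blast
  have contg': "continuous_on V (\<lambda>y. g' y h)" for h
  proof -
    \<comment> \<open>Resolvent identity: \<open>f' (g z)\<close> and \<open>f' (g y)\<close> send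
      \<open>g' z h\<close> and \<open>g' y h\<close> to the same vector \<open>h\<close>. Each of
      the two inverses contributes a factor 2 to the constant 4.\<close>
    have *: "norm (g' z h - g' y h) \<le> 4 * norm (f' (g z) - f' (g y)) * norm h"
      if y: "y \<in> V" and z: "z \<in> V" for y z
    proof -
      have "f' (g z) (g' z h - g' y h) = - ((f' (g z) - f' (g y)) (g' y h))"
        using fg'[OF y] fg'[OF z] by (simp add: blinfun.diff_right blinfun.diff_left)
      then have "norm (g' z h - g' y h) \<le> 2 * norm ((f' (g z) - f' (g y)) (g' y h))"
        using half[OF gW[OF z], of "g' z h - g' y h"] by simp
      also have "\<dots> \<le> 2 * (norm (f' (g z) - f' (g y)) * norm (g' y h))"
        by (intro mult_left_mono norm_blinfun) simp
      also have "norm (g' y h) \<le> 2 * norm h"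
        using half[OF gW[OF y], of "g' y h"] fg'[OF y] by simp
      finally show ?thesis
        by (simp add: mult_left_mono mult.assoc)
    qed
    have "continuous_on V (\<lambda>y. f' (g y))"
      using homeomorphism_cont2[OF hom] subset_trans[OF image_subsetI[OF gW] W(3)]
      by (rule continuous_on_compose2[OF cont])
    then have c: "((\<lambda>z. f' (g z)) \<longlongrightarrow> f' (g y)) (at y within V)" if "y \<in> V" for y
      using that by (simp add: continuous_on_def)
    show ?thesis
      unfolding continuous_on_def
    proof
      fix y assume y: "y \<in> V"
      have "((\<lambda>z. 4 * norm (f' (g z) - f' (g y)) * norm h) \<longlongrightarrow> 0) (at y within V)"
        using c[OF y] by (auto intro!: tendsto_eq_intros)
      moreover have "\<forall>\<^sub>F z in at y within V. norm (g' z h - g' y h) \<le> 4 * norm (f' (g z) - f' (g y)) * norm h"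
        using * y by (auto simp: eventually_at_filter)
      ultimately have "((\<lambda>z. g' z h - g' y h) \<longlongrightarrow> 0) (at y within V)"
        by (rule Lim_null_comparison[rotated])
      then show "((\<lambda>z. g' z h) \<longlongrightarrow> g' y h) (at y within V)"
        by (simp add: LIM_zero_iff)
    qed
  qed
  then have "continuous_on V (\<lambda>y. Blinfun (g' y))"
    by (intro continuous_on_blinfun_componentwise)
      (auto simp: bounded_linear_Blinfun_apply bl cong: continuous_on_cong)
  then have "C1_on V g"
    unfolding C1_on_def
    by (intro exI[of _ "\<lambda>y. Blinfun (g' y)"]) (simp add: bounded_linear_Blinfun_apply bl g'(1))
  moreover have "C1_on U' f"
    unfolding C1_on_def using f' continuous_on_subset[OF cont] UV(2) W(3)
    by (intro exI[of _ f']) blast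
  ultimately show ?thesis
    using UV W(3) hom by (intro that[of U' V g]) auto
qed

section \<open>Constructing submanifolds, and their tangent vectors\<close>

text \<open>The local inverse \<open>g\<close> of \<open>f\<close> straightens the image of
  \<open>L \<inter> U'\<close> back to \<open>L \<inter> U'\<close>, so one chart serves all points
  of \<open>M\<close>.\<close>

lemma C1_submanifold_image:
  fixes f :: "'a::euclidean_space \<Rightarrow> 'a"
  assumes "C1_on U f" "open U" "0 \<in> U" "(f has_derivative (\<lambda>h. h)) (at 0)"
    and "subspace L" "f ` (L \<inter> U) \<subseteq> S"
  shows "\<exists>M. M \<noteq> {} \<and> M \<subseteq> S \<and> C1_submanifold (dim L) M"
proof -
  obtain U' V g where UV: "open U'" "U' \<subseteq> U" "0 \<in> U'" "open V"
    and hom: "homeomorphism U' V f g" and C1: "C1_on U' f" "C1_on V g"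
    using C1_local_inverse[OF assms(1-4)] by blast
  define M where "M = f ` (L \<inter> U')"
  have "g (f x) = x" "f x \<in> V" if "x \<in> U'" for x
    using hom that by (auto simp: homeomorphism_def)
  then have "M \<subseteq> V" "g ` M = L \<inter> U'"
    by (auto simp: M_def image_image)
  then have "g ` (M \<inter> V) = L \<inter> U'"
    by (simp add: Int_absorb2)
  moreover have "x \<in> V" if "x \<in> M" for x
    using that \<open>M \<subseteq> V\<close> by blast
  ultimately have "C1_submanifold (dim L) M"
    unfolding C1_submanifold_def
    using UV(1,4) C1 assms(5) homeomorphism_symD[OF hom] by (intro ballI exI conjI) auto
  moreover have "M \<noteq> {}" "M \<subseteq> S"
    using UV(2,3) assms(5,6) subspace_0 by (auto simp: M_def)
  ultimately show ?thesis by blast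
qed

text \<open>\<open>D\<close> is the derivative of the inverse chart \<open>\<psi>\<close> at
  \<open>\<phi> x\<close>, and \<open>c\<close> samples the curve
  \<open>\<psi> (y + t *\<^sub>R h)\<close>. A sequence is enough, since later only limits along
  subsequences are taken.\<close>

lemma C1_submanifold_tangent:
  fixes M :: "'a::euclidean_space set"
  assumes "C1_submanifold d M" "x \<in> M"
  obtains D :: "'a \<Rightarrow> 'a" and L where "linear D" "subspace L" "dim L = d" "inj D"
    "\<forall>h\<in>L. \<exists>c t. (\<forall>i::nat. c i \<in> M \<and> t i > (0::real)) \<and> t \<longlonglongrightarrow> 0 \<and> c \<longlonglongrightarrow> x \<and>
       (\<lambda>i. (c i - x) /\<^sub>R t i) \<longlonglongrightarrow> D h"
proof -
  obtain U V \<phi> \<psi> L where UV: "open U" "open V" "x \<in> U" and hom: "homeomorphism U V \<phi> \<psi>"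
    and C1: "C1_on U \<phi>" "C1_on V \<psi>" and L: "subspace L" "dim L = d" "\<phi> ` (M \<inter> U) = L \<inter> V"
    using assms unfolding C1_submanifold_def by meson
  define y where "y = \<phi> x"
  have y: "y \<in> L \<inter> V" "\<psi> y = x"
    using L(3) assms(2) UV(3) hom by (auto simp: y_def homeomorphism_def)
  obtain D where D: "(\<psi> has_derivative D) (at y)"
    using C1(2) y(1) unfolding C1_on_def by blast
  obtain E where E: "(\<phi> has_derivative E) (at x)"
    using C1(1) UV(3) unfolding C1_on_def by blast
  \<comment> \<open>The chain rule for \<open>\<phi> (\<psi> z) = z\<close> makes \<open>E\<close> a
    left inverse of \<open>D\<close>, whence \<open>D\<close> is injective.\<close>
  have "((\<lambda>z. \<phi> (\<psi> z)) has_derivative (\<lambda>h. E (D h))) (at y)"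
    using has_derivative_compose[OF D, of \<phi> E] E y(2) by simp
  then have "((\<lambda>z. z) has_derivative (\<lambda>h. E (D h))) (at y)"
    using y(1) UV(2) hom
    by (rule_tac has_derivative_transform_within_open[of "\<lambda>z. \<phi> (\<psi> z)"])
      (auto simp: homeomorphism_def)
  then have "(\<lambda>h. E (D h)) = (\<lambda>h. h)"
    using has_derivative_unique[OF _ has_derivative_ident] by blast
  then have "inj D"
    by (metis injI)
  moreover have lin: "linear D"
    using D has_derivative_linear by blast
  moreover have "\<exists>c t. (\<forall>i::nat. c i \<in> M \<and> t i > (0::real)) \<and> t \<longlonglongrightarrow> 0 \<and> c \<longlonglongrightarrow> x \<and>
       (\<lambda>i. (c i - x) /\<^sub>R t i) \<longlonglongrightarrow> D h" if h: "h \<in> L" for h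
  proof -
    have "((\<lambda>t. \<psi> (y + t *\<^sub>R h)) has_derivative (\<lambda>t. D (t *\<^sub>R h))) (at 0)"
      by (rule has_derivative_compose[of "\<lambda>t. y + t *\<^sub>R h" "\<lambda>t. t *\<^sub>R h"])
        (auto intro!: derivative_eq_intros simp: D)
    then have "((\<lambda>t. \<psi> (y + t *\<^sub>R h)) has_vector_derivative D h) (at 0)"
      by (simp add: has_vector_derivative_def linear_cmul[OF lin])
    then have 1: "((\<lambda>t. (\<psi> (y + t *\<^sub>R h) - x) /\<^sub>R t) \<longlongrightarrow> D h) (at 0)"
      unfolding has_vector_derivative_def has_derivative_at
    proof (elim conjE)
      assume "(\<lambda>t. norm (\<psi> (y + (0 + t) *\<^sub>R h) - \<psi> (y + 0 *\<^sub>R h) - t *\<^sub>R D h) / norm t) \<midarrow>0\<rightarrow> 0"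
      moreover have "\<forall>\<^sub>F t in at 0. norm (\<psi> (y + (0 + t) *\<^sub>R h) - \<psi> (y + 0 *\<^sub>R h) - t *\<^sub>R D h) / norm t
          = norm ((\<psi> (y + t *\<^sub>R h) - x) /\<^sub>R t - D h)"
      proof (intro eventually_at_filter[THEN iffD2] always_eventually allI impI)
        fix t :: real assume "t \<noteq> 0"
        then have "(\<psi> (y + t *\<^sub>R h) - x) /\<^sub>R t - D h = (\<psi> (y + t *\<^sub>R h) - x - t *\<^sub>R D h) /\<^sub>R t"
          by (simp add: scaleR_diff_right)
        then show "norm (\<psi> (y + (0 + t) *\<^sub>R h) - \<psi> (y + 0 *\<^sub>R h) - t *\<^sub>R D h) / norm t
          = norm ((\<psi> (y + t *\<^sub>R h) - x) /\<^sub>R t - D h)"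
          using y(2) by (simp add: divide_inverse_commute)
      qed
      ultimately show ?thesis
        by (simp add: tendsto_cong tendsto_norm_zero_iff LIM_zero_iff)
    qed
    have 2: "((\<lambda>t. \<psi> (y + t *\<^sub>R h)) \<longlongrightarrow> x) (at 0)"
      using \<open>(_ has_vector_derivative _) _\<close> y(2) has_vector_derivative_continuous
      by (fastforce simp: continuous_at)
    have "((\<lambda>t. y + t *\<^sub>R h) \<longlongrightarrow> y) (at (0::real))"
      by (auto intro!: tendsto_eq_intros)
    then have "\<forall>\<^sub>F t in at (0::real). y + t *\<^sub>R h \<in> V"
      using UV(2) y(1) by (auto dest: topological_tendstoD)
    then have 3: "\<forall>\<^sub>F t in at (0::real). \<psi> (y + t *\<^sub>R h) \<in> M"
    proof eventually_elim
      case (elim t)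
      then have "y + t *\<^sub>R h \<in> L \<inter> V"
        using L(1) y(1) h by (auto intro: subspace_add subspace_scale)
      then obtain m where "m \<in> M \<inter> U" "y + t *\<^sub>R h = \<phi> m"
        using L(3) by blast
      then show ?case using hom by (auto simp: homeomorphism_def)
    qed
    have lim: "filterlim (\<lambda>i. inverse (real (Suc i))) (at 0) sequentially"
      using LIMSEQ_inverse_real_of_nat by (simp add: filterlim_at)
    then obtain N where N: "\<And>i. i \<ge> N \<Longrightarrow> \<psi> (y + inverse (real (Suc i)) *\<^sub>R h) \<in> M"
      using eventually_compose_filterlim[OF 3 lim] unfolding eventually_sequentially by blast
    \<comment> \<open>The shift by \<open>N\<close> drops the finitely many sample points that may
      lie outside \<open>M\<close>.\<close>
    define t where "t i = inverse (real (Suc (i + N)))" for i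
    have tM: "\<psi> (y + t i *\<^sub>R h) \<in> M" and tpos: "t i > 0" for i
      using N[of "i + N"] by (simp_all add: t_def)
    have lim: "filterlim t (at 0) sequentially"
      unfolding t_def using filterlim_compose[OF lim filterlim_add_const_nat_at_top[of N]] by simp
    show ?thesis
      by (rule exI[of _ "\<lambda>i. \<psi> (y + t i *\<^sub>R h)"], rule exI[of _ t])
        (use filterlim_compose[OF 1 lim] filterlim_compose[OF 2 lim] lim tM tpos
          in \<open>auto simp: filterlim_at\<close>)
  qed
  ultimately show ?thesis
    using L(1,2) by (intro that[of D L] ballI)
qed

section \<open>The Cayley transform\<close>

lemma matrix_diff_ldistrib: "A ** (B - C) = A ** B - A ** (C :: real^'p^'m)" for A :: "real^'m^'n"
  by (simp add: vec_eq_iff matrix_matrix_mult_def right_diff_distrib sum_subtractf)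

lemma matrix_diff_rdistrib: "(A - B) ** C = A ** C - B ** (C :: real^'p^'m)" for A :: "real^'m^'n"
  by (simp add: vec_eq_iff matrix_matrix_mult_def left_diff_distrib sum_subtractf)

lemma matrix_add_rdistrib: "(A + B) ** C = A ** C + B ** (C :: real^'p^'m)" for A :: "real^'m^'n"
  by (simp add: vec_eq_iff matrix_matrix_mult_def distrib_right sum.distrib)

text \<open>This is \<open>(1 - K)^(-1) (1 + K)\<close>, solved column by column with Cramer's rule.
  In this form the entries are quotients of polynomials in the entries of \<open>K\<close>, which
  gives their smoothness.\<close>

definition cayley :: "real^'n^'n \<Rightarrow> real^'n^'n" where
  "cayley K = (\<chi> i j. det (\<chi> p q. if q = i then (mat 1 + K) $ p $ j else (mat 1 - K) $ p $ q)
                  / det (mat 1 - K))"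

context
  fixes K :: "real^'n^'n"
  assumes skew: "transpose K = - K"
begin

text \<open>If \<open>K x = x\<close> with \<open>K\<close> skew, then
  \<open>x \<bullet> K x\<close> equals its own negative, so
  \<open>x \<bullet> x = 0\<close>.\<close>

lemma det_mat_minus_skew: "det (mat 1 - K) \<noteq> 0"
proof -
  have "x = 0" if "(mat 1 - K) *v x = 0" for x
  proof -
    have *: "K *v x = x"
      using that by (simp add: matrix_vector_mult_diff_rdistrib)
    have "x \<bullet> (K *v x) = (transpose K *v x) \<bullet> x"
      by (simp add: dot_lmul_matrix[symmetric])
    also have "transpose K *v x = - (K *v x)"
      unfolding skew by (simp add: vec_eq_iff matrix_vector_mult_def sum_negf)
    finally show ?thesis using * by simp
  qed
  then show ?thesis
    by (meson invertible_det_nz invertible_left_inverse matrix_left_invertible_ker)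
qed

lemma cayley_eq: "(mat 1 - K) ** cayley K = mat 1 + K"
proof -
  have "((mat 1 - K) ** cayley K) $ i $ j = (mat 1 + K) $ i $ j" for i j
  proof -
    have "(mat 1 - K) *v column j (cayley K) = column j (mat 1 + K)"
      unfolding cramer[OF det_mat_minus_skew]
      by (simp add: column_def cayley_def cong: if_cong)
    then have "((mat 1 - K) *v column j (cayley K)) $ i = (mat 1 + K) $ i $ j"
      by (simp add: column_def)
    then show ?thesis
      by (simp add: matrix_matrix_mult_def matrix_vector_mult_def column_def)
  qed
  then show ?thesis by (simp add: vec_eq_iff)
qed

text \<open>Transposition exchanges \<open>1 - K\<close> and \<open>1 + K\<close>, and the two
  commute. Hence \<open>Q (1 - K) = 1 + K\<close> and \<open>Q^T (1 + K) = 1 - K\<close>, and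
  \<open>1 - K\<close> can be cancelled from \<open>Q^T Q (1 - K) = 1 - K\<close>.\<close>

lemma orthogonal_cayley: "orthogonal_matrix (cayley K)"
proof -
  let ?P = "mat 1 - K" and ?N = "mat 1 + K" and ?Q = "cayley K"
  obtain R where R: "R ** ?P = mat 1" "?P ** R = mat 1"
    using det_mat_minus_skew by (metis invertible_det_nz invertible_def)
  have "transpose ?P = mat 1 - transpose K" "transpose ?N = mat 1 + transpose K"
    by (simp_all add: vec_eq_iff transpose_def mat_def)
  then have tr: "transpose ?P = ?N" "transpose ?N = ?P"
    using skew by simp_all
  have comm: "?P ** ?N = ?N ** ?P"
    by (simp add: matrix_add_ldistrib matrix_add_rdistrib matrix_diff_ldistrib matrix_diff_rdistrib)
  have "?P ** (?Q ** ?P) = ?P ** ?N"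
    by (metis matrix_mul_assoc cayley_eq comm)
  then have QP: "?Q ** ?P = ?N"
    by (metis R(1) matrix_mul_assoc matrix_mul_lid)
  have "transpose ?Q ** ?N = ?P"
    by (metis cayley_eq matrix_transpose_mul tr)
  then have "transpose ?Q ** ?Q ** ?P = ?P"
    by (simp add: matrix_mul_assoc[symmetric] QP)
  then have "transpose ?Q ** ?Q = mat 1"
    by (metis R(2) matrix_mul_assoc matrix_mul_rid)
  then show ?thesis by (simp add: orthogonal_matrix)
qed

end

lemma C1_real_cayley:
  fixes K :: "'a::euclidean_space \<Rightarrow> real^'n^'n"
  assumes "\<And>x. transpose (K x) = - K x" "\<And>i j. C1_real (\<lambda>x. K x $ i $ j)"
  shows "C1_real (\<lambda>x. cayley (K x) $ i $ j)"
proof -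
  have 1: "C1_real (\<lambda>x. (mat 1 + K x) $ p $ q)" for p q
    unfolding vector_add_component by (intro C1_real_add C1_real_const assms(2))
  have "C1_real (\<lambda>x. (mat 1 $ p $ q) + (- 1) * K x $ p $ q)" for p q
    by (intro C1_real_add C1_real_mult C1_real_const assms(2))
  then have 2: "C1_real (\<lambda>x. (mat 1 - K x) $ p $ q)" for p q
    by (simp add: mat_def)
  define B where "B x = (\<chi> p q. if q = i then (mat 1 + K x) $ p $ j else (mat 1 - K x) $ p $ q)" for x
  have 3: "C1_real (\<lambda>x. B x $ p $ q)" for p q
    unfolding B_def using 1 2 by (cases "q = i") simp_all
  have "cayley (K x) $ i $ j = det (B x) / det (mat 1 - K x)" for x
    by (simp add: cayley_def B_def)
  then show ?thesis
    using C1_real_divide[OF C1_real_det[OF 3] C1_real_det[OF 2] det_mat_minus_skew[OF assms(1)]]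
    by simp
qed

text \<open>Differentiating \<open>Q = 1 + K + K Q\<close> at a zero of \<open>K\<close>, where \<open>Q = 1\<close>, gives \<open>Q' = 2 K'\<close>.\<close>

lemma has_derivative_cayley_0:
  fixes K :: "'a::euclidean_space \<Rightarrow> real^'n^'n"
  assumes "\<And>x. transpose (K x) = - K x" "\<And>i j. bounded_linear (\<lambda>x. K x $ i $ j)"
  shows "((\<lambda>x. cayley (K x) $ i $ j) has_derivative (\<lambda>h. 2 * K h $ i $ j)) (at 0)"
proof -
  have K0: "K 0 = 0"
    using linear_simps(3)[OF assms(2)] by (simp add: vec_eq_iff)
  have Q: "cayley (K x) = mat 1 + K x + K x ** cayley (K x)" for x
    using cayley_eq[OF assms(1), of x] by (simp add: matrix_diff_rdistrib algebra_simps)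
  have Q0: "cayley (K 0) = mat 1"
    using Q[of 0] by (simp add: K0)
  \<comment> \<open>Existence of the derivative \<open>q\<close> comes first. Its value follows
    below because, when \<open>K Q\<close> is differentiated, the term with \<open>q\<close> carries
    the factor \<open>K 0 = 0\<close>.\<close>
  obtain q where q: "\<And>i j. ((\<lambda>x. cayley (K x) $ i $ j) has_derivative q i j) (at 0)"
  proof -
    have "\<exists>q. ((\<lambda>x. cayley (K x) $ i $ j) has_derivative q) (at 0)" for i j
      using C1_real_cayley[OF assms(1) C1_real_linear[OF assms(2)], of i j]
      unfolding C1_real_def by blast
    then show ?thesis using that by metis
  qed
  have "((\<lambda>x. mat 1 $ i $ j + K x $ i $ j + (\<Sum>l\<in>UNIV. K x $ i $ l * cayley (K x) $ l $ j))
      has_derivative (\<lambda>h. 0 + K h $ i $ j +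
        (\<Sum>l\<in>UNIV. K 0 $ i $ l * q l j h + K h $ i $ l * cayley (K 0) $ l $ j))) (at 0)"
    by (intro has_derivative_add has_derivative_const has_derivative_sum has_derivative_mult q
        bounded_linear_imp_has_derivative assms(2))
  moreover have "mat 1 $ i $ j + K x $ i $ j + (\<Sum>l\<in>UNIV. K x $ i $ l * cayley (K x) $ l $ j)
      = cayley (K x) $ i $ j" for x
  proof -
    have "cayley (K x) $ i $ j = (mat 1 + K x + K x ** cayley (K x)) $ i $ j"
      using Q by metis
    then show ?thesis by (simp add: matrix_matrix_mult_def)
  qed
  moreover have "0 + K h $ i $ j + (\<Sum>l\<in>UNIV. K 0 $ i $ l * q l j h + K h $ i $ l * cayley (K 0) $ l $ j)
      = 2 * K h $ i $ j" for h
    unfolding Q0 by (simp add: K0 mat_def if_distrib cong: if_cong)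
  ultimately show ?thesis by simp
qed

section \<open>A chart adapted to the action of the orthogonal groups on both sides\<close>

text \<open>By the product rule and \<open>Q' = 2 K'\<close> the derivative of \<open>F\<close> at
  \<open>0\<close> is \<open>2 K A + T - 2 A L\<close>; the minus sign comes from transposing the
  skew \<open>L\<close>. Assumption \<open>eq\<close> says that this is the identity.\<close>

lemma orbit_chart:
  fixes K :: "real^'m^'n \<Rightarrow> real^'n^'n" and L :: "real^'m^'n \<Rightarrow> real^'m^'m"
    and T :: "real^'m^'n \<Rightarrow> real^'m^'n" and A :: "real^'m^'n"
  assumes K: "\<And>X. transpose (K X) = - K X" "\<And>i j. bounded_linear (\<lambda>X. K X $ i $ j)"
    and L: "\<And>X. transpose (L X) = - L X" "\<And>i j. bounded_linear (\<lambda>X. L X $ i $ j)"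
    and T: "\<And>i j. bounded_linear (\<lambda>X. T X $ i $ j)"
    and eq: "\<And>X. 2 *\<^sub>R (K X ** A) + T X - 2 *\<^sub>R (A ** L X) = X"
  defines "F \<equiv> \<lambda>X. cayley (K X) ** (A + T X) ** transpose (cayley (L X))"
  shows "C1_on UNIV F" "(F has_derivative (\<lambda>X. X)) (at 0)"
proof -
  have F: "F X $ i $ j =
      (\<Sum>b\<in>UNIV. (\<Sum>a\<in>UNIV. cayley (K X) $ i $ a * (A $ a $ b + T X $ a $ b)) * cayley (L X) $ j $ b)"
    for X i j
    by (simp add: F_def matrix_matrix_mult_def transpose_def)
  have "C1_real (\<lambda>X. F X $ i $ j)" for i j
    unfolding F
    by (intro C1_real_sum C1_real_mult C1_real_add C1_real_const C1_real_cayley C1_real_linear K L T)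
  then show "C1_on UNIV F"
    by (rule C1_on_matrix)
  have 0: "K 0 = 0" "L 0 = 0" "T 0 = 0"
    using linear_simps(3)[OF K(2)] linear_simps(3)[OF L(2)] linear_simps(3)[OF T]
    by (simp_all add: vec_eq_iff)
  have c0: "cayley (0 :: real^'k^'k) = mat 1"
    using cayley_eq[of "0 :: real^'k^'k"] by (simp add: transpose_def vec_eq_iff)
  have comp: "((\<lambda>X. F X $ i $ j) has_derivative (\<lambda>X. X $ i $ j)) (at 0)" for i j
  proof -
    have "((\<lambda>X. F X $ i $ j) has_derivative (\<lambda>X. \<Sum>b\<in>UNIV.
        (\<Sum>a\<in>UNIV. cayley (K 0) $ i $ a * (A $ a $ b + T 0 $ a $ b)) * (2 * L X $ j $ b)
      + (\<Sum>a\<in>UNIV. cayley (K 0) $ i $ a * (0 + T X $ a $ b) + 2 * K X $ i $ a * (A $ a $ b + T 0 $ a $ b))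
        * cayley (L 0) $ j $ b)) (at 0)"
      unfolding F
      by (intro has_derivative_sum has_derivative_mult has_derivative_add has_derivative_const
          has_derivative_cayley_0 bounded_linear_imp_has_derivative K L T)
    moreover have "(\<Sum>b\<in>UNIV.
        (\<Sum>a\<in>UNIV. cayley (K 0) $ i $ a * (A $ a $ b + T 0 $ a $ b)) * (2 * L X $ j $ b)
      + (\<Sum>a\<in>UNIV. cayley (K 0) $ i $ a * (0 + T X $ a $ b) + 2 * K X $ i $ a * (A $ a $ b + T 0 $ a $ b))
        * cayley (L 0) $ j $ b) = X $ i $ j" for X
    proof -
      have sk: "L X $ b $ j = - L X $ j $ b" for b
        using arg_cong[OF L(1)[of X], of "\<lambda>M. M $ j $ b"] by (simp add: transpose_def)
      have "X $ i $ j = (2 *\<^sub>R (K X ** A) + T X - 2 *\<^sub>R (A ** L X)) $ i $ j"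
        by (simp add: eq)
      also have "\<dots> = 2 * (\<Sum>a\<in>UNIV. K X $ i $ a * A $ a $ j) + T X $ i $ j - 2 * (\<Sum>b\<in>UNIV. A $ i $ b * L X $ b $ j)"
        by (simp add: matrix_matrix_mult_def)
      also have "(\<Sum>b\<in>UNIV. A $ i $ b * L X $ b $ j) = - (\<Sum>b\<in>UNIV. A $ i $ b * L X $ j $ b)"
        by (subst sk) (simp add: sum_negf)
      finally show ?thesis
        by (simp add: 0 c0 mat_def if_distrib[of "\<lambda>x. x * _"] if_distrib[of "\<lambda>x. _ * x"]
            sum.distrib sum_distrib_left ac_simps cong: if_cong)
    qed
    ultimately show ?thesis by simp
  qed
  show "(F has_derivative (\<lambda>X. X)) (at 0)"
    unfolding has_derivative_componentwise_within[of F]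
  proof
    fix b :: "real^'m^'n" assume "b \<in> Basis"
    then obtain i j where "b = axis i (axis j 1)"
      by (auto simp: Basis_vec_def)
    then show "((\<lambda>X. F X \<bullet> b) has_derivative (\<lambda>X. X \<bullet> b)) (at 0)"
      using comp[of i j] by (simp add: inner_axis)
  qed
qed

section \<open>The tangent space of the stratum and its dimension\<close>

lemma bij_betw_idx: "bij_betw (idx :: 'n::finite \<Rightarrow> nat) UNIV {..<CARD('n)}"
  unfolding idx_def by (rule to_nat_on_finite) simp

lemma idx_less [simp]: "idx (i :: 'n::finite) < CARD('n)"
  using bij_betw_apply[OF bij_betw_idx, of i] by simp

lemma idx_eq_iff [simp]: "idx i = idx j \<longleftrightarrow> i = (j :: 'n::finite)"
  using bij_betw_idx[where 'n = 'n] by (auto simp: bij_betw_def inj_eq)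

text \<open>\<open>ix (idx j)\<close> carries a column index to the row index with the same number,
  and conversely. The value is unspecified when the number is out of range, so such entries must
  come with a factor zero.\<close>

definition ix :: "nat \<Rightarrow> 'n::finite" where
  "ix = inv_into UNIV idx"

lemma idx_ix [simp]: "a < CARD('n::finite) \<Longrightarrow> idx (ix a :: 'n) = a"
  using bij_betw_inv_into_right[OF bij_betw_idx, of a] by (simp add: ix_def)

lemma ix_idx [simp]: "ix (idx i) = (i :: 'n::finite)"
  unfolding ix_def by (rule bij_betw_inv_into_left[OF bij_betw_idx]) simp

lemma dim_coordinate_subspace:
  fixes F :: "('n::finite \<times> 'm::finite) set"
  shows "dim {Y :: real^'m^'n. \<forall>i j. (i, j) \<notin> F \<longrightarrow> Y $ i $ j = 0} = card F"
proof -
  define e where "e = (\<lambda>(i, j). axis i (axis j 1) :: real^'m^'n)"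
  have inj: "inj e"
    by (auto simp: inj_def e_def axis_eq_axis)
  have Basis: "(Basis :: (real^'m^'n) set) = range e"
    by (auto simp: Basis_vec_def e_def)
  have "e ` F \<subseteq> Basis"
    by (auto simp: Basis)
  then have "dim {Y :: real^'m^'n. \<forall>b\<in>Basis. b \<notin> e ` F \<longrightarrow> Y \<bullet> b = 0} = card F"
    using dim_substandard[of "e ` F"] inj by (simp add: card_image inj_on_subset)
  moreover have "(\<forall>b\<in>Basis. b \<notin> e ` F \<longrightarrow> Y \<bullet> b = 0) \<longleftrightarrow> (\<forall>i j. (i, j) \<notin> F \<longrightarrow> Y $ i $ j = 0)" for Y
    using inj by (simp add: Basis inj_image_mem_iff) (simp add: e_def inner_axis)
  ultimately show ?thesis by simp
qed

text \<open>The tangent space of the stratum at \<open>diag_mat s\<close>.\<close>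

definition stratum_tangent :: "real list \<Rightarrow> (real^'m^'n) set" where
  "stratum_tangent s = {X.
     (\<forall>i j. length s \<le> idx i \<longrightarrow> length s \<le> idx j \<longrightarrow> X $ i $ j = 0) \<and>
     (\<forall>a<length s. \<forall>b<length s. s ! a = s ! b \<longrightarrow>
        X $ ix a $ ix a = X $ ix b $ ix b \<and> (a \<noteq> b \<longrightarrow> X $ ix a $ ix b + X $ ix b $ ix a = 0))}"

lemma stratum_tangentI:
  assumes "\<And>i j. length s \<le> idx i \<Longrightarrow> length s \<le> idx j \<Longrightarrow> X $ i $ j = 0"
    and "\<And>a b. a < length s \<Longrightarrow> b < length s \<Longrightarrow> s ! a = s ! b \<Longrightarrow> X $ ix a $ ix a = X $ ix b $ ix b"
    and "\<And>a b. a < length s \<Longrightarrow> b < length s \<Longrightarrow> s ! a = s ! b \<Longrightarrow> a \<noteq> b \<Longrightarrow>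
      X $ ix a $ ix b + X $ ix b $ ix a = 0"
  shows "X \<in> stratum_tangent s"
  unfolding stratum_tangent_def using assms by blast

lemma stratum_tangentD:
  assumes "X \<in> stratum_tangent s"
  shows "length s \<le> idx i \<Longrightarrow> length s \<le> idx j \<Longrightarrow> X $ i $ j = 0"
    and "a < length s \<Longrightarrow> b < length s \<Longrightarrow> s ! a = s ! b \<Longrightarrow> X $ ix a $ ix a = X $ ix b $ ix b"
    and "a < length s \<Longrightarrow> b < length s \<Longrightarrow> s ! a = s ! b \<Longrightarrow> a \<noteq> b \<Longrightarrow>
      X $ ix a $ ix b = - X $ ix b $ ix a"
  using assms unfolding stratum_tangent_def eq_neg_iff_add_eq_0 by blast+

lemma subspace_stratum_tangent: "subspace (stratum_tangent s)"
proof (rule subspaceI)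
  fix X Y :: "real^'m^'n" assume X: "X \<in> stratum_tangent s" and Y: "Y \<in> stratum_tangent s"
  show "X + Y \<in> stratum_tangent s"
  proof (rule stratum_tangentI)
    fix a b assume "a < length s" "b < length s" "s ! a = s ! b"
    from stratum_tangentD(2)[OF X this] stratum_tangentD(2)[OF Y this]
    show "(X + Y) $ ix a $ ix a = (X + Y) $ ix b $ ix b"
      by (simp only: vector_add_component)
  next
    fix a b assume "a < length s" "b < length s" "s ! a = s ! b" "a \<noteq> b"
    from stratum_tangentD(3)[OF X this] stratum_tangentD(3)[OF Y this]
    show "(X + Y) $ ix a $ ix b + (X + Y) $ ix b $ ix a = 0"
      by simp
  qed (simp add: stratum_tangentD(1)[OF X] stratum_tangentD(1)[OF Y])
next
  fix c and X :: "real^'m^'n" assume X: "X \<in> stratum_tangent s"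
  show "c *\<^sub>R X \<in> stratum_tangent s"
  proof (rule stratum_tangentI)
    fix a b assume "a < length s" "b < length s" "s ! a = s ! b"
    from stratum_tangentD(2)[OF X this] show "(c *\<^sub>R X) $ ix a $ ix a = (c *\<^sub>R X) $ ix b $ ix b"
      by (simp only: vector_scaleR_component)
  next
    fix a b assume "a < length s" "b < length s" "s ! a = s ! b" "a \<noteq> b"
    from stratum_tangentD(3)[OF X this] show "(c *\<^sub>R X) $ ix a $ ix b + (c *\<^sub>R X) $ ix b $ ix a = 0"
      by simp
  qed (simp add: stratum_tangentD(1)[OF X])
qed (simp add: stratum_tangent_def)

text \<open>A canonical position for each value. The fixed points of \<open>first_eq s\<close> among
  the positions of \<open>s\<close> correspond to the distinct values in \<open>s\<close>.\<close>

definition first_eq :: "'a list \<Rightarrow> nat \<Rightarrow> nat" where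
  "first_eq s a = (LEAST c. s ! c = s ! a)"

lemma first_eq: "s ! first_eq s a = s ! a" "first_eq s a \<le> a"
  unfolding first_eq_def by (rule LeastI[of _ a], simp) (rule Least_le, simp)

lemma first_eq_cong: "s ! a = s ! b \<Longrightarrow> first_eq s a = first_eq s b"
  by (simp add: first_eq_def)

text \<open>The entries that can be chosen freely in \<open>stratum_tangent s\<close>: inside a
  block of equal singular values the strictly upper entries and one diagonal entry, and every entry
  outside these blocks and outside the zero block.\<close>

definition tangent_coord :: "real list \<Rightarrow> nat \<Rightarrow> nat \<Rightarrow> bool" where
  "tangent_coord s a b \<longleftrightarrow> (a < length s \<or> b < length s) \<and>
     (a < length s \<and> b < length s \<and> s ! a = s ! b \<longrightarrow> a < b \<or> a = b \<and> first_eq s a = a)"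

text \<open>\<open>E\<close> fills in the dependent entries from the free ones: a lower entry is
  minus its mirror image, a diagonal entry is copied from the representative. It maps the coordinate
  subspace \<open>C\<close> bijectively onto the tangent space.\<close>

lemma dim_stratum_tangent_eq_card:
  fixes s :: "real list"
  assumes "length s \<le> min CARD('n) CARD('m)"
  shows "dim (stratum_tangent s :: (real^'m^'n) set) =
    card {(a, b). a < CARD('n) \<and> b < CARD('m) \<and> tangent_coord s a b}"
proof -
  let ?r = "length s"
  define F :: "('n \<times> 'm) set" where "F = {(i, j). tangent_coord s (idx i) (idx j)}"
  define C :: "(real^'m^'n) set" where "C = {Y. \<forall>i j. (i, j) \<notin> F \<longrightarrow> Y $ i $ j = 0}"
  define E :: "real^'m^'n \<Rightarrow> real^'m^'n" where
    "E Y = (\<chi> i j. if ?r \<le> idx i \<and> ?r \<le> idx j then 0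
       else if idx i < ?r \<and> idx j < ?r \<and> s ! idx i = s ! idx j then
         (if idx i < idx j then Y $ i $ j
          else if idx j < idx i then - Y $ ix (idx j) $ ix (idx i)
          else Y $ ix (first_eq s (idx i)) $ ix (first_eq s (idx i)))
       else Y $ i $ j)" for Y
  have less: "a < CARD('n)" "a < CARD('m)" if "a < ?r" for a
    using that assms by auto
  have lin: "linear E"
    by (rule linearI) (simp_all add: E_def vec_eq_iff)
  have E_F: "E Y $ i $ j = Y $ i $ j" if "(i, j) \<in> F" for Y i j
  proof -
    have "ix (idx j) = i" if "idx i = idx j"
      using that by (metis ix_idx)
    then show ?thesis
      using that by (auto simp: F_def tangent_coord_def E_def)
  qed
  have sub: "subspace C"
    by (rule subspaceI) (simp_all add: C_def)
  have "inj_on E C"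
  proof (rule inj_onI)
    fix X Y assume "X \<in> C" "Y \<in> C" and eq: "E X = E Y"
    then have "X $ i $ j = Y $ i $ j" for i j
      using E_F[of i j X] E_F[of i j Y] by (cases "(i, j) \<in> F") (simp_all add: C_def)
    then show "X = Y" by (simp add: vec_eq_iff)
  qed
  then have "dim (E ` C) = dim C"
    using lin sub by (intro dim_image_eq) (simp_all add: span_eq_iff[THEN iffD2])
  also have "E ` C = stratum_tangent s"
  proof
    show "E ` C \<subseteq> stratum_tangent s"
    proof (intro image_subsetI stratum_tangentI)
      fix Y and a b :: nat assume "a < ?r" "b < ?r" "s ! a = s ! b"
      then show "E Y $ ix a $ ix a = E Y $ ix b $ ix b"
        using first_eq_cong[of s a b] by (simp add: E_def less)
    qed (auto simp: E_def less)
    show "stratum_tangent s \<subseteq> E ` C"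
    proof
      fix X :: "real^'m^'n" assume X: "X \<in> stratum_tangent s"
      define Y :: "real^'m^'n" where "Y = (\<chi> i j. if (i, j) \<in> F then X $ i $ j else 0)"
      have "Y \<in> C"
        by (simp add: C_def Y_def)
      moreover have "E Y $ i $ j = X $ i $ j" for i j
      proof (cases "(i, j) \<in> F")
        case True
        then show ?thesis by (simp add: E_F) (simp add: Y_def)
      next
        case False
        \<comment> \<open>An entry that is not free lies in the zero block, strictly below the
          diagonal of a block, or on its diagonal away from the representative.\<close>
        then consider "?r \<le> idx i" "?r \<le> idx j"
          | "idx i < ?r" "idx j < idx i" "s ! idx i = s ! idx j"
          | "idx i < ?r" "idx i = idx j" "first_eq s (idx i) \<noteq> idx i"
          by (force simp: F_def tangent_coord_def)
        then show ?thesis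
        proof cases
          case 1
          then show ?thesis using X by (simp add: E_def stratum_tangent_def)
        next
          case 2
          then have "(ix (idx j), ix (idx i)) \<in> F"
            by (simp add: F_def tangent_coord_def less)
          moreover have "X $ ix (idx i) $ ix (idx j) = - X $ ix (idx j) $ ix (idx i)"
            using 2 by (intro stratum_tangentD(3)[OF X]) auto
          ultimately show ?thesis
            using 2 by (simp add: E_def Y_def)
        next
          case 3
          let ?f = "first_eq s (idx i)"
          have f: "?f < ?r" "s ! ?f = s ! idx i" "first_eq s ?f = ?f"
            using first_eq[of s "idx i"] first_eq_cong[of s ?f "idx i"] 3(1) by auto
          then have "(ix ?f, ix ?f) \<in> F"
            by (simp add: F_def tangent_coord_def less)
          moreover have "X $ ix (idx i) $ ix (idx j) = X $ ix ?f $ ix ?f"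
            using stratum_tangentD(2)[OF X 3(1) f(1) f(2)[symmetric]] 3(2) by simp
          moreover have "ix (idx j) = i"
            using 3(2) by (metis ix_idx)
          ultimately show ?thesis
            using 3 by (simp add: E_def Y_def)
        qed
      qed
      ultimately show "X \<in> E ` C"
        by (intro image_eqI[of _ _ Y]) (simp_all add: vec_eq_iff)
    qed
  qed
  also have "dim C = card F"
    unfolding C_def by (rule dim_coordinate_subspace)
  also have "card F = card {(a, b). a < CARD('n) \<and> b < CARD('m) \<and> tangent_coord s a b}"
  proof (rule bij_betw_same_card)
    show "bij_betw (map_prod idx idx) F {(a, b). a < CARD('n) \<and> b < CARD('m) \<and> tangent_coord s a b}"
      by (rule bij_betw_byWitness[where f' = "map_prod ix ix"]) (auto simp: F_def)
  qed
  finally show ?thesis .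
qed

section \<open>Counting the free coordinates\<close>

text \<open>For fixed \<open>a\<close>, the number of partners \<open>b\<close> is the multiplicity
  of \<open>s ! a\<close>.\<close>

lemma card_eq_pairs:
  "card {(a, b). a < length s \<and> b < length s \<and> s ! a = s ! b} = (\<Sum>x\<in>#mset s. count (mset s) x)"
proof -
  have "{(a, b). a < length s \<and> b < length s \<and> s ! a = s ! b}
      = (SIGMA a:{..<length s}. {b. b < length s \<and> s ! b = s ! a})"
    by auto
  then have "card {(a, b). a < length s \<and> b < length s \<and> s ! a = s ! b}
      = (\<Sum>a<length s. card {b. b < length s \<and> s ! b = s ! a})"
    by (simp add: card_SigmaI)
  also have "\<dots> = (\<Sum>a<length s. count (mset s) (s ! a))"
    by (simp add: count_mset count_list_eq_length_filter length_filter_conv_card eq_commute)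
  also have "\<dots> = sum_list (map (\<lambda>x. count (mset s) x) s)"
    by (simp add: sum_list_sum_nth atLeast0LessThan)
  finally show ?thesis
    by (simp add: sum_mset_sum_list[symmetric])
qed

text \<open>The set \<open>B\<close> of all entries outside the zero block has
  \<open>n m - (n - r)(m - r) = (n + m - r) r\<close> elements. The pairs \<open>Q\<close> of equal
  values are removed, and of these the strictly upper ones \<open>Ql\<close> and the representatives
  \<open>Df\<close> are put back. By symmetry \<open>Q\<close> has \<open>2 |Ql| + r\<close>
  elements, while \<open>Df\<close> has one element for each distinct value.\<close>

lemma card_tangent_coord:
  fixes s :: "real list"
  assumes "length s \<le> n" "length s \<le> m"
  shows "real (card {(a, b). a < n \<and> b < m \<and> tangent_coord s a b}) =
    (real n + real m - length s) * length s - length s / 2 + card (set s)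
      - real (\<Sum>x\<in>#mset s. count (mset s) x) / 2"
proof -
  let ?r = "length s"
  define Q where "Q = {(a, b). a < ?r \<and> b < ?r \<and> s ! a = s ! b}"
  define Ql where "Ql = {(a, b). a < ?r \<and> b < ?r \<and> s ! a = s ! b \<and> a < b}"
  define D where "D = {(a, b). a < ?r \<and> a = b}"
  define Df where "Df = {(a, b). a < ?r \<and> a = b \<and> first_eq s a = a}"
  define B where "B = {..<n} \<times> {..<m} - {?r..<n} \<times> {?r..<m}"
  define N where "N = {(a, b). a < n \<and> b < m \<and> tangent_coord s a b}"
  have Qfin: "finite Q"
    by (rule finite_subset[of _ "{..<?r} \<times> {..<?r}"]) (auto simp: Q_def)
  have sub: "Ql \<subseteq> Q" "D \<subseteq> Q" "Df \<subseteq> Q" "Q \<subseteq> B"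
    using assms by (auto simp: Ql_def Q_def D_def Df_def B_def)
  have fin: "finite Ql" "finite D" "finite Df" "finite B"
    using sub Qfin by (auto intro: finite_subset simp: B_def)
  have swap: "(a, b) \<in> prod.swap ` Ql \<longleftrightarrow> (b, a) \<in> Ql" for a b
    by (auto simp: image_iff intro: bexI[of _ "(b, a)"])
  have "(a, b) \<in> Q \<longleftrightarrow> (a, b) \<in> Ql \<union> prod.swap ` Ql \<union> D" for a b
    unfolding Un_iff swap by (cases a b rule: linorder_cases) (auto simp: Q_def Ql_def D_def)
  then have "Q = Ql \<union> prod.swap ` Ql \<union> D"
    by (intro set_eqI) (simp only: split_paired_all)
  moreover have "Ql \<inter> prod.swap ` Ql = {}" "(Ql \<union> prod.swap ` Ql) \<inter> D = {}"
    by (auto simp: Ql_def D_def)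
  moreover have "card (prod.swap ` Ql) = card Ql"
    by (intro card_image inj_onI) auto
  ultimately have Q: "card Q = 2 * card Ql + card D"
    using fin by (simp add: card_Un_disjoint)
  have "D = (\<lambda>a. (a, a)) ` {..<?r}"
    by (auto simp: D_def)
  then have D: "card D = ?r"
    by (simp add: card_image inj_on_def)
  have "bij_betw (\<lambda>(a, b). s ! a) Df (set s)"
    unfolding bij_betw_def
  proof
    show "inj_on (\<lambda>(a, b). s ! a) Df"
    proof (rule inj_onI)
      fix x y assume "x \<in> Df" "y \<in> Df" and eq: "(case x of (a, b) \<Rightarrow> s ! a) = (case y of (a, b) \<Rightarrow> s ! a)"
      then obtain a b where "x = (a, a)" "first_eq s a = a" "y = (b, b)" "first_eq s b = b"
        by (auto simp: Df_def)
      then show "x = y"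
        using eq first_eq_cong[of s a b] by simp
    qed
    show "(\<lambda>(a, b). s ! a) ` Df = set s"
    proof
      show "set s \<subseteq> (\<lambda>(a, b). s ! a) ` Df"
      proof
        fix v assume "v \<in> set s"
        then obtain a where a: "a < ?r" "v = s ! a"
          by (auto simp: in_set_conv_nth)
        have "(first_eq s a, first_eq s a) \<in> Df"
          using a first_eq[of s a] first_eq_cong[of s "first_eq s a" a] by (simp add: Df_def)
        then show "v \<in> (\<lambda>(a, b). s ! a) ` Df"
          using a(2) first_eq(1)[of s a] by (intro image_eqI[of _ _ "(first_eq s a, first_eq s a)"]) simp_all
      qed
    qed (auto simp: Df_def)
  qed
  then have Df: "card Df = card (set s)"
    by (rule bij_betw_same_card)
  have "N = (B - Q) \<union> (Ql \<union> Df)"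
    using assms by (auto simp: N_def B_def Q_def Ql_def Df_def tangent_coord_def)
  moreover have "Ql \<inter> Df = {}"
    by (auto simp: Ql_def Df_def)
  moreover have "(B - Q) \<inter> (Ql \<union> Df) = {}"
    using sub by blast
  ultimately have "card N = card (B - Q) + (card Ql + card Df)"
    using fin by (simp add: card_Un_disjoint)
  also have "card (B - Q) = card B - card Q"
    using Qfin sub(4) by (rule card_Diff_subset)
  finally have "card N = card B - card Q + (card Ql + card Df)" .
  \<comment> \<open>Ensures that the subtraction of natural numbers is not truncated.\<close>
  moreover have "card Q \<le> card B"
    using sub(4) fin(4) by (rule card_mono[rotated])
  ultimately have N: "real (card N) = real (card B) - card Q + (card Ql + card Df)"
    by simp
  have "card B = n * m - (n - ?r) * (m - ?r)"
    unfolding B_def by (subst card_Diff_subset) auto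
  moreover have "(n - ?r) * (m - ?r) \<le> n * m"
    by (intro mult_le_mono) auto
  ultimately have "real (card B) = real n * m - (real n - ?r) * (real m - ?r)"
    using assms by (simp add: of_nat_diff)
  moreover have "real (\<Sum>x\<in>#mset s. count (mset s) x) = 2 * real (card Ql) + ?r"
    unfolding card_eq_pairs[symmetric] Q_def[symmetric] Q D by simp
  ultimately show ?thesis
    using N Q D Df unfolding N_def[symmetric] by (simp add: field_simps)
qed

section \<open>A chart of the stratum at a diagonal matrix\<close>

text \<open>The diagonal continued by zeros, so that the positions beyond the singular values form
  one more block, with value 0.\<close>

definition dg :: "real list \<Rightarrow> nat \<Rightarrow> real" where
  "dg s a = (if a < length s then s ! a else 0)"

lemma diag_mat_nth: "diag_mat s $ i $ j = (if idx i = idx j then dg s (idx i) else 0)"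
  by (simp add: diag_mat_def dg_def)

lemma sum_idx_delta:
  fixes f :: "'n::finite \<Rightarrow> real"
  shows "(\<Sum>i\<in>UNIV. f i * (if idx i = a then c else 0)) = (if a < CARD('n) then f (ix a) * c else 0)"
proof (cases "a < CARD('n)")
  case True
  then have "idx i = a \<longleftrightarrow> i = ix a" for i :: 'n
    by (metis idx_ix ix_idx)
  then show ?thesis using True by (simp add: if_distrib[of "\<lambda>x. _ * x"] cong: if_cong)
next
  case False
  then have "idx i \<noteq> a" for i :: 'n
    using idx_less[of i] by metis
  then show ?thesis using False by simp
qed

text \<open>If \<open>idx j\<close> is no row number of the diagonal matrix, then
  \<open>ix (idx j)\<close> is unspecified, but \<open>dg s (idx j) = 0\<close> by the length
  assumption.\<close>

lemma matrix_mult_diag_mat_nth: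
  fixes A :: "real^'n^'k"
  assumes "length s \<le> CARD('n)"
  shows "(A ** (diag_mat s :: real^'m^'n)) $ i $ j = A $ i $ ix (idx j) * dg s (idx j)"
proof -
  have "(A ** (diag_mat s :: real^'m^'n)) $ i $ j
      = (\<Sum>l\<in>UNIV. A $ i $ l * (if idx l = idx j then dg s (idx j) else 0))"
    unfolding matrix_matrix_mult_def by (auto simp: diag_mat_nth intro!: sum.cong)
  then show ?thesis
    using assms by (simp add: sum_idx_delta dg_def)
qed

lemma diag_mat_mult_matrix_nth:
  fixes A :: "real^'k^'m"
  assumes "length s \<le> CARD('m)"
  shows "((diag_mat s :: real^'m^'n) ** A) $ i $ j = dg s (idx i) * A $ ix (idx i) $ j"
proof -
  have "((diag_mat s :: real^'m^'n) ** A) $ i $ j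
      = (\<Sum>l\<in>UNIV. A $ l $ j * (if idx l = idx i then dg s (idx i) else 0))"
    unfolding matrix_matrix_mult_def by (auto simp: diag_mat_nth intro!: sum.cong)
  then show ?thesis
    using assms by (simp add: sum_idx_delta dg_def)
qed

text \<open>The linear maps \<open>K\<close>, \<open>L\<close>, \<open>T\<close> solve \<open>K D + T - D L = X\<close> for \<open>D = diag_mat s\<close>, with \<open>K\<close>, \<open>L\<close> skew
  and \<open>T\<close> normal to the orbit of \<open>D\<close>. The entries \<open>(i, j)\<close> and \<open>(j, i)\<close> decouple into a linear system with
  determinant \<open>b\<^sup>2 - a\<^sup>2\<close> where \<open>a\<close>, \<open>b\<close> are the diagonal entries of \<open>D\<close> at \<open>i\<close>, \<open>j\<close>; for \<open>a = b = 0\<close>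
  the division by zero in \<open>tangent_K\<close> gives the intended value \<open>0\<close>.\<close>

definition tangent_K :: "real list \<Rightarrow> real^'m^'n \<Rightarrow> real^'n^'n" where
  "tangent_K s X = (\<chi> i j. let a = dg s (idx i); b = dg s (idx j) in
     if a = b then (X $ i $ ix (idx j) - X $ j $ ix (idx i)) / (2 * a)
     else (b * X $ i $ ix (idx j) + a * X $ j $ ix (idx i)) / (b\<^sup>2 - a\<^sup>2))"

definition tangent_L :: "real list \<Rightarrow> real^'m^'n \<Rightarrow> real^'m^'m" where
  "tangent_L s X = (\<chi> i j. let a = dg s (idx i); b = dg s (idx j) in
     if a = b then 0
     else (a * X $ ix (idx i) $ j + b * X $ ix (idx j) $ i) / (b\<^sup>2 - a\<^sup>2))"

definition tangent_T :: "real list \<Rightarrow> real^'m^'n \<Rightarrow> real^'m^'n" where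
  "tangent_T s X = (\<chi> i j. let a = dg s (idx i); b = dg s (idx j) in
     if a \<noteq> b then 0 else if a = 0 then X $ i $ j
     else (X $ i $ j + X $ ix (idx j) $ ix (idx i)) / 2)"

lemma divide_minus_diff: "x / (a - b) = - (x / (b - a))" for x a b :: real
  by (metis minus_diff_eq minus_divide_right)

text \<open>Exchanging \<open>i\<close> and \<open>j\<close> exchanges \<open>a\<close> with
  \<open>b\<close> and \<open>Y\<close> with \<open>Z\<close>. For \<open>a = b\<close> the
  numerator changes sign, otherwise the denominator does.\<close>

lemma transpose_tangent_K: "transpose (tangent_K s X) = - tangent_K s X"
proof -
  have "tangent_K s X $ j $ i = - tangent_K s X $ i $ j" for i j
  proof -
    define a b where "a = dg s (idx i)" and "b = dg s (idx j)"
    define Y Z where "Y = X $ i $ ix (idx j)" and "Z = X $ j $ ix (idx i)"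
    have "(Z - Y) / (2 * b) = - ((Y - Z) / (2 * b))"
      by (simp add: minus_divide_left)
    moreover have "(a * Z + b * Y) / (a\<^sup>2 - b\<^sup>2) = - ((b * Y + a * Z) / (b\<^sup>2 - a\<^sup>2))"
      unfolding add.commute[of "a * Z"] by (rule divide_minus_diff)
    moreover have "tangent_K s X $ i $ j = (if a = b then (Y - Z) / (2 * a) else (b * Y + a * Z) / (b\<^sup>2 - a\<^sup>2))"
      "tangent_K s X $ j $ i = (if b = a then (Z - Y) / (2 * b) else (a * Z + b * Y) / (a\<^sup>2 - b\<^sup>2))"
      by (simp_all only: tangent_K_def vec_lambda_beta Let_def a_def b_def Y_def Z_def)
    ultimately show ?thesis by auto
  qed
  then show ?thesis
    unfolding vec_eq_iff transpose_def vec_lambda_beta vector_uminus_component by blast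
qed

lemma transpose_tangent_L: "transpose (tangent_L s X) = - tangent_L s X"
proof -
  have "tangent_L s X $ j $ i = - tangent_L s X $ i $ j" for i j
  proof -
    define a b where "a = dg s (idx i)" and "b = dg s (idx j)"
    define Y Z where "Y = X $ ix (idx i) $ j" and "Z = X $ ix (idx j) $ i"
    have "(b * Z + a * Y) / (a\<^sup>2 - b\<^sup>2) = - ((a * Y + b * Z) / (b\<^sup>2 - a\<^sup>2))"
      unfolding add.commute[of "b * Z"] by (rule divide_minus_diff)
    moreover have "tangent_L s X $ i $ j = (if a = b then 0 else (a * Y + b * Z) / (b\<^sup>2 - a\<^sup>2))"
      "tangent_L s X $ j $ i = (if b = a then 0 else (b * Z + a * Y) / (a\<^sup>2 - b\<^sup>2))"
      by (simp_all only: tangent_L_def vec_lambda_beta Let_def a_def b_def Y_def Z_def)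
    ultimately show ?thesis by auto
  qed
  then show ?thesis
    unfolding vec_eq_iff transpose_def vec_lambda_beta vector_uminus_component by blast
qed

lemma bounded_linear_matrix_nth: "bounded_linear (\<lambda>X :: real^'m^'n. X $ i $ j)"
  by (rule bounded_linear_compose[OF bounded_linear_vec_nth bounded_linear_vec_nth])

lemma bounded_linear_tangent:
  "bounded_linear (\<lambda>X. tangent_K s X $ i $ i')"
  "bounded_linear (\<lambda>X. tangent_L s X $ j $ j')"
  "bounded_linear (\<lambda>X. tangent_T s X $ i $ j)"
proof -
  have bounded_linear_if: "bounded_linear (\<lambda>x. if c then f x else g x)"
    if "bounded_linear f" "bounded_linear g" for c and f g :: "'x::real_normed_vector \<Rightarrow> real"
    using that by (cases c) simp_all
  note intros = bounded_linear_if bounded_linear_mult_const bounded_linear_add bounded_linear_sub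
    bounded_linear_const_mult bounded_linear_matrix_nth bounded_linear_zero
  show "bounded_linear (\<lambda>X. tangent_K s X $ i $ i')"
    unfolding tangent_K_def vec_lambda_beta Let_def divide_inverse by (intro intros)
  show "bounded_linear (\<lambda>X. tangent_L s X $ j $ j')"
    unfolding tangent_L_def vec_lambda_beta Let_def divide_inverse by (intro intros)
  show "bounded_linear (\<lambda>X. tangent_T s X $ i $ j)"
    unfolding tangent_T_def vec_lambda_beta Let_def divide_inverse by (intro intros)
qed

lemma tangent_splitting:
  fixes X :: "real^'m^'n"
  assumes "length s \<le> min CARD('n) CARD('m)" and pos: "\<And>x. x \<in> set s \<Longrightarrow> 0 < x"
  shows "tangent_K s X ** diag_mat s + tangent_T s X - diag_mat s ** tangent_L s X = X"
proof -
  have "(tangent_K s X ** diag_mat s + tangent_T s X - diag_mat s ** tangent_L s X) $ i $ j = X $ i $ j"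
    for i j
  proof -
    define a b where "a = dg s (idx i)" and "b = dg s (idx j)"
    define Y where "Y = X $ ix (idx j) $ ix (idx i)"
    \<comment> \<open>For \<open>b = 0\<close> both sides vanish, whatever \<open>ix (idx j)\<close>
      is; for \<open>b \<noteq> 0\<close> the number \<open>idx j\<close> is in range for rows. The
      same holds for \<open>a\<close> and \<open>L\<close> below.\<close>
    have K: "tangent_K s X $ i $ ix (idx j) * b = (if a = b then (X $ i $ j - Y) / (2 * a)
       else (b * X $ i $ j + a * Y) / (b\<^sup>2 - a\<^sup>2)) * b"
    proof (cases "b = 0")
      case False
      then have "idx j < CARD('n)"
        using assms by (auto simp: b_def dg_def split: if_splits)
      then show ?thesis
        by (simp add: tangent_K_def Let_def a_def b_def Y_def)
    qed simp
    have L: "a * tangent_L s X $ ix (idx i) $ j = a * (if a = b then 0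
       else (a * X $ i $ j + b * Y) / (b\<^sup>2 - a\<^sup>2))"
    proof (cases "a = 0")
      case False
      then have "idx i < CARD('m)"
        using assms by (auto simp: a_def dg_def split: if_splits)
      then show ?thesis
        by (simp add: tangent_L_def Let_def a_def b_def Y_def)
    qed simp
    have T: "tangent_T s X $ i $ j = (if a \<noteq> b then 0 else if a = 0 then X $ i $ j else (X $ i $ j + Y) / 2)"
      by (simp add: tangent_T_def Let_def a_def b_def Y_def)
    have "(tangent_K s X ** diag_mat s + tangent_T s X - diag_mat s ** tangent_L s X) $ i $ j =
        tangent_K s X $ i $ ix (idx j) * b + tangent_T s X $ i $ j - a * tangent_L s X $ ix (idx i) $ j"
      using assms by (simp add: matrix_mult_diag_mat_nth diag_mat_mult_matrix_nth a_def b_def)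
    also have "\<dots> = X $ i $ j"
    \<comment> \<open>For \<open>a = b > 0\<close> the skew part of the entry is carried by
      \<open>K\<close> and the symmetric part by \<open>T\<close>; for \<open>a = b = 0\<close>
      everything is in \<open>T\<close>. For \<open>a \<noteq> b\<close> the terms with
      \<open>Y\<close> cancel, and \<open>b\<^sup>2 \<noteq> a\<^sup>2\<close> because both values
      are nonnegative.\<close>
    proof (cases "a = b")
      case True
      then show ?thesis unfolding K L T by (simp add: field_simps)
    next
      case False
      have "0 \<le> a" "0 \<le> b"
        using pos by (auto simp: a_def b_def dg_def less_imp_le)
      then have nz: "b\<^sup>2 - a\<^sup>2 \<noteq> 0"
        using False by (simp add: power2_eq_iff_nonneg)
      have "(b * X $ i $ j + a * Y) * b - a * (a * X $ i $ j + b * Y) = X $ i $ j * (b\<^sup>2 - a\<^sup>2)"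
        by (simp add: algebra_simps power2_eq_square)
      then have "(b * X $ i $ j + a * Y) / (b\<^sup>2 - a\<^sup>2) * b - a * ((a * X $ i $ j + b * Y) / (b\<^sup>2 - a\<^sup>2)) = X $ i $ j"
        using nz by (simp add: diff_divide_distrib[symmetric])
      then show ?thesis using False unfolding K L T by simp
    qed
    finally show ?thesis .
  qed
  then show ?thesis by (simp add: vec_eq_iff)
qed

text \<open>For \<open>X\<close> in the tangent space the zero block of \<open>X\<close> vanishes
  and the symmetric part of each other block is a scalar. So
  \<open>diag_mat s + tangent_T s X\<close> is again diagonal, and equal singular values are shifted
  equally, that is, by a function \<open>f\<close> of the value.\<close>

lemma stratum_local_chart:
  fixes s :: "real list"
  assumes len: "length s \<le> min CARD('n) CARD('m)" and pos: "\<And>x. x \<in> set s \<Longrightarrow> 0 < x"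
  obtains F :: "real^'m^'n \<Rightarrow> real^'m^'n"
  where "C1_on UNIV F" "(F has_derivative (\<lambda>X. X)) (at 0)"
    "\<And>X. X \<in> stratum_tangent s \<Longrightarrow> \<exists>Q R f. orthogonal_matrix Q \<and> orthogonal_matrix R \<and>
       (\<forall>a<length s. f (s ! a) = s ! a + X $ ix a $ ix a) \<and>
       F X = Q ** diag_mat (map f s) ** transpose R"
proof -
  \<comment> \<open>The factor 1/2 compensates the factor 2 in the derivative of the Cayley
    transform.\<close>
  define K :: "real^'m^'n \<Rightarrow> real^'n^'n" where "K X = (1/2) *\<^sub>R tangent_K s X" for X
  define L :: "real^'m^'n \<Rightarrow> real^'m^'m" where "L X = (1/2) *\<^sub>R tangent_L s X" for X
  define F :: "real^'m^'n \<Rightarrow> real^'m^'n" where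
    "F X = cayley (K X) ** (diag_mat s + tangent_T s X) ** transpose (cayley (L X))" for X
  have transpose_scale: "transpose ((1/2) *\<^sub>R M) = (1/2) *\<^sub>R transpose M" for M :: "real^'k^'k"
    by (simp add: vec_eq_iff transpose_def)
  have K: "transpose (K X) = - K X" "bounded_linear (\<lambda>X. K X $ i $ i')" for X i i'
    unfolding K_def vector_scaleR_component real_scaleR_def
    by (simp_all only: transpose_scale transpose_tangent_K scaleR_minus_right bounded_linear_const_mult
        bounded_linear_tangent)
  have L: "transpose (L X) = - L X" "bounded_linear (\<lambda>X. L X $ j $ j')" for X j j'
    unfolding L_def vector_scaleR_component real_scaleR_def
    by (simp_all only: transpose_scale transpose_tangent_L scaleR_minus_right bounded_linear_const_mult
        bounded_linear_tangent)
  have "2 *\<^sub>R (K X ** diag_mat s) + tangent_T s X - 2 *\<^sub>R (diag_mat s ** L X) = X" for X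
  proof -
    have "2 *\<^sub>R (K X ** (diag_mat s :: real^'m^'n)) = tangent_K s X ** diag_mat s"
      by (simp add: K_def vec_eq_iff matrix_matrix_mult_def sum_distrib_left)
    moreover have "2 *\<^sub>R ((diag_mat s :: real^'m^'n) ** L X) = diag_mat s ** tangent_L s X"
      by (simp add: L_def vec_eq_iff matrix_matrix_mult_def sum_distrib_left)
    ultimately show ?thesis using tangent_splitting[OF len pos, of X] by simp
  qed
  note chart = orbit_chart[OF K L bounded_linear_tangent(3) this]
  have "\<exists>Q R f. orthogonal_matrix Q \<and> orthogonal_matrix R \<and>
       (\<forall>a<length s. f (s ! a) = s ! a + X $ ix a $ ix a) \<and>
       F X = Q ** diag_mat (map f s) ** transpose R" if X: "X \<in> stratum_tangent s" for X
  proof -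
    \<comment> \<open>The choice of the position \<open>a\<close> is immaterial, since the diagonal
      of \<open>X\<close> is constant on the positions of one value.\<close>
    define f where "f v = (let a = SOME a. a < length s \<and> s ! a = v in v + X $ ix a $ ix a)" for v
    have f: "f (s ! a) = s ! a + X $ ix a $ ix a" if "a < length s" for a
    proof -
      define b where "b = (SOME b. b < length s \<and> s ! b = s ! a)"
      have "b < length s \<and> s ! b = s ! a"
        unfolding b_def by (rule someI[of _ a]) (simp add: that)
      then show ?thesis
        using stratum_tangentD(2)[OF X, of b a] that by (simp add: f_def b_def[symmetric])
    qed
    have "(diag_mat s + tangent_T s X) $ i $ j = (diag_mat (map f s) :: real^'m^'n) $ i $ j" for i j
    proof -
      have nz: "dg s a = 0 \<longleftrightarrow> length s \<le> a" for a
        using pos[OF nth_mem, of a] by (cases "a < length s") (simp_all add: dg_def)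
      consider "length s \<le> idx i" "length s \<le> idx j" | "dg s (idx i) \<noteq> dg s (idx j)"
        | "idx i < length s" "idx j < length s" "s ! idx i = s ! idx j"
        using nz by (metis dg_def not_le)
      then show ?thesis
      proof cases
        case 1
        then show ?thesis
          using stratum_tangentD(1)[OF X 1] nz by (simp add: tangent_T_def diag_mat_nth dg_def)
      next
        case 2
        then have "idx i \<noteq> idx j" by auto
        then show ?thesis
          using 2 by (simp add: tangent_T_def diag_mat_nth)
      next
        case 3
        show ?thesis
        proof (cases "idx i = idx j")
          case True
          then have "ix (idx j) = i"
            by (metis ix_idx)
          then show ?thesis
            using 3 True nz[of "idx i"] f[of "idx i"] by (simp add: tangent_T_def diag_mat_nth dg_def)
        next
          case False
          then show ?thesis
            using 3 nz[of "idx i"] stratum_tangentD(3)[OF X 3 False]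
            by (simp add: tangent_T_def diag_mat_nth dg_def)
        qed
      qed
    qed
    then have "diag_mat s + tangent_T s X = (diag_mat (map f s) :: real^'m^'n)"
      by (simp only: vec_eq_iff) blast
    then show ?thesis
      using f orthogonal_cayley[OF K(1)] orthogonal_cayley[OF L(1)] unfolding F_def
      by (intro exI[of _ "cayley (K X)"] exI[of _ "cayley (L X)"] exI[of _ f]) simp
  qed
  then show ?thesis
    using chart unfolding F_def[symmetric] by (intro that[of F]) auto
qed

section \<open>Multisets with prescribed multiplicities, and the dimension formula\<close>

lemma image_mset_sum_replicate:
  "image_mset f (\<Sum>j\<in>A. replicate_mset (k j) (\<sigma> j)) = (\<Sum>j\<in>A. replicate_mset (k j) (f (\<sigma> j)))"
  by (induction A rule: infinite_finite_induct) simp_all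

lemma sum_mset_sum_replicate:
  fixes g :: "'a \<Rightarrow> nat"
  shows "(\<Sum>x\<in>#(\<Sum>j\<in>A. replicate_mset (k j) (\<sigma> j)). g x) = (\<Sum>j\<in>A. k j * g (\<sigma> j))"
  by (induction A rule: infinite_finite_induct) simp_all

lemma count_sum_replicate:
  assumes "finite A" "inj_on \<sigma> A" "i \<in> A"
  shows "count (\<Sum>j\<in>A. replicate_mset (k j) (\<sigma> j)) (\<sigma> i) = k i"
proof -
  have "count (\<Sum>j\<in>A. replicate_mset (k j) (\<sigma> j)) (\<sigma> i) = (\<Sum>j\<in>A. if j = i then k j else 0)"
    using assms by (auto simp: count_sum inj_on_eq_iff intro!: sum.cong)
  then show ?thesis using assms by simp
qed

lemma set_mset_sum_replicate:
  assumes "finite A" "\<And>j. j \<in> A \<Longrightarrow> k j > 0"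
  shows "set_mset (\<Sum>j\<in>A. replicate_mset (k j) (\<sigma> j)) = \<sigma> ` A"
  using assms
proof (induction A)
  case (insert i A)
  then have "set_mset (\<Sum>j\<in>A. replicate_mset (k j) (\<sigma> j)) = \<sigma> ` A" and "k i \<noteq> 0"
    by (blast, metis insertI1 less_not_refl)
  then show ?case using insert.hyps by simp
qed simp

text \<open>The sum of all counts over \<open>mset s\<close> is the sum of the squares of the
  \<open>k j\<close>, and these add up to \<open>r\<close> plus the sum of
  \<open>k j * (k j - 1)\<close>. The result depends on the multiplicities alone, so tangent spaces
  at different diagonal matrices of the stratum have equal dimension.\<close>

lemma dim_stratum_tangent:
  fixes J r :: nat and k :: "nat \<Rightarrow> nat" and s :: "real list"
  assumes k: "\<And>j. j \<in> {1..J} \<Longrightarrow> k j > 0" and r: "r = (\<Sum>j=1..J. k j)"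
    and len: "r \<le> min CARD('n::finite) CARD('m::finite)"
    and inj: "inj_on \<sigma> {1..J}" and s: "mset s = (\<Sum>j=1..J. replicate_mset (k j) (\<sigma> j))"
  shows "length s = r" and "card (set s) = J"
    and "real (dim (stratum_tangent s :: (real^'m^'n) set)) =
    (real CARD('n) + real CARD('m) - real r) * real r - real r
      - 1 / 2 * (\<Sum>j=1..J. real (k j) * (real (k j) - 1)) + real J"
proof -
  have "length s = size (mset s)" by simp
  also have "\<dots> = (\<Sum>j=1..J. k j)"
    using sum_mset_sum_replicate[of "\<lambda>_. 1" k \<sigma> "{1..J}"] unfolding s by simp
  finally show 1: "length s = r" using r by simp
  have "set s = set_mset (mset s)" by simp
  also have "\<dots> = \<sigma> ` {1..J}"
    unfolding s by (rule set_mset_sum_replicate) (use k in auto)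
  finally show 2: "card (set s) = J"
    using inj by (simp add: card_image)
  have "(\<Sum>x\<in>#mset s. count (mset s) x) = (\<Sum>j=1..J. k j * count (mset s) (\<sigma> j))"
    by (subst s) (rule sum_mset_sum_replicate)
  also have "\<dots> = (\<Sum>j=1..J. k j * k j)"
    using inj by (intro sum.cong refl) (simp add: s count_sum_replicate)
  finally have 3: "real (\<Sum>x\<in>#mset s. count (mset s) x) = (\<Sum>j=1..J. real (k j) * real (k j))"
    by (simp only: of_nat_sum of_nat_mult)
  have "dim (stratum_tangent s :: (real^'m^'n) set) =
      card {(a, b). a < CARD('n) \<and> b < CARD('m) \<and> tangent_coord s a b}"
    by (rule dim_stratum_tangent_eq_card) (use 1 len in simp)
  then have "real (dim (stratum_tangent s :: (real^'m^'n) set)) =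
    (real CARD('n) + real CARD('m) - r) * r - r / 2 + J - (\<Sum>j=1..J. real (k j) * real (k j)) / 2"
    using card_tangent_coord[of s "CARD('n)" "CARD('m)"] 1 2 3 len by simp
  moreover have "(\<Sum>j=1..J. real (k j) * (real (k j) - 1)) = (\<Sum>j=1..J. real (k j) * real (k j)) - r"
    unfolding r by (simp add: right_diff_distrib sum_subtractf)
  ultimately show "real (dim (stratum_tangent s :: (real^'m^'n) set)) =
    (real CARD('n) + real CARD('m) - real r) * real r - real r
      - 1 / 2 * (\<Sum>j=1..J. real (k j) * (real (k j) - 1)) + real J"
    by (simp add: field_simps)
qed

section \<open>The lower bound for the dimension\<close>

lemma singular_stratum_submanifold:
  fixes J r :: nat and k :: "nat \<Rightarrow> nat"
  assumes k: "\<And>j. j \<in> {1..J} \<Longrightarrow> k j > 0" and r: "r = (\<Sum>j=1..J. k j)"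
    and len: "r \<le> min CARD('n::finite) CARD('m::finite)"
  obtains s \<sigma> M where "inj_on \<sigma> {1..J}" "mset s = (\<Sum>j=1..J. replicate_mset (k j) (\<sigma> j))"
    "M \<noteq> {}" "M \<subseteq> singular_stratum J k"
    "C1_submanifold (dim (stratum_tangent s :: (real^'m^'n) set)) (M :: (real^'m^'n) set)"
proof -
  \<comment> \<open>The values \<open>J, ..., 1\<close> have gaps at least 1 and are at least 1.
    Entries of \<open>X\<close> below 1/2 in modulus move each value by less than 1/2, which
    preserves order and positivity.\<close>
  define \<sigma> where "\<sigma> j = real (J + 1 - j)" for j
  have \<sigma>: "\<sigma> j \<ge> \<sigma> i + 1" if "i \<in> {1..J}" "j \<in> {1..J}" "j < i" for i j
    using that by (simp add: \<sigma>_def)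
  have \<sigma>1: "\<sigma> j \<ge> 1" if "j \<in> {1..J}" for j
    using that by (simp add: \<sigma>_def)
  have inj: "inj_on \<sigma> {1..J}"
    by (auto simp: inj_on_def \<sigma>_def)
  obtain s where s: "mset s = (\<Sum>j=1..J. replicate_mset (k j) (\<sigma> j))"
    using ex_mset by blast
  have lens: "length s \<le> min CARD('n) CARD('m)"
    using dim_stratum_tangent(1)[OF k r len inj s] len by simp
  have sets: "set s = \<sigma> ` {1..J}"
    using set_mset_sum_replicate[of "{1..J}" k \<sigma>] k unfolding s[symmetric] by simp
  obtain F :: "real^'m^'n \<Rightarrow> real^'m^'n" where F: "C1_on UNIV F" "(F has_derivative (\<lambda>X. X)) (at 0)"
    and chart: "\<And>X. X \<in> stratum_tangent s \<Longrightarrow> \<exists>Q R f. orthogonal_matrix Q \<and> orthogonal_matrix R \<and>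
       (\<forall>a<length s. f (s ! a) = s ! a + X $ ix a $ ix a) \<and>
       F X = Q ** diag_mat (map f s) ** transpose R"
  proof (rule stratum_local_chart[OF lens])
    show "0 < x" if "x \<in> set s" for x
      using that \<sigma>1 unfolding sets by force
  qed blast
  have "F X \<in> singular_stratum J k" if X: "X \<in> stratum_tangent s" "X \<in> ball 0 (1/2)" for X
  proof -
    obtain Q R f where QR: "orthogonal_matrix Q" "orthogonal_matrix R"
      and f: "\<And>a. a < length s \<Longrightarrow> f (s ! a) = s ! a + X $ ix a $ ix a"
      and FX: "F X = Q ** diag_mat (map f s) ** transpose R"
      using chart[OF X(1)] by blast
    have small: "\<bar>X $ i $ j\<bar> < 1/2" for i j
    proof -
      have "\<bar>X $ i $ j\<bar> \<le> norm (X $ i)" by (rule component_le_norm_cart)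
      also have "\<dots> \<le> norm X" by (rule Finite_Cartesian_Product.norm_nth_le)
      finally show ?thesis using X(2) by simp
    qed
    have f\<sigma>: "\<bar>f (\<sigma> j) - \<sigma> j\<bar> < 1/2" if "j \<in> {1..J}" for j
    proof -
      have "\<sigma> j \<in> set s" using that sets by blast
      then obtain a where "a < length s" "s ! a = \<sigma> j"
        by (auto simp: in_set_conv_nth)
      then show ?thesis using f[of a] small[of "ix a" "ix a"] by simp
    qed
    have "f (\<sigma> i) > f (\<sigma> j)" if "i \<in> {1..J}" "j \<in> {1..J}" "i < j" for i j
      using f\<sigma>[OF that(1)] f\<sigma>[OF that(2)] \<sigma>[OF that(2,1,3)] by linarith
    moreover have pos: "f (\<sigma> j) > 0" if "j \<in> {1..J}" for j
      using f\<sigma>[OF that] \<sigma>1[OF that] by linarith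
    moreover have "has_singular_values (F X) (\<Sum>j=1..J. replicate_mset (k j) (f (\<sigma> j)))"
      unfolding has_singular_values_def is_svd_def
    proof (intro exI conjI)
      show "(\<Sum>j=1..J. replicate_mset (k j) (f (\<sigma> j))) = mset (map f s)"
        by (simp add: s image_mset_sum_replicate)
      show "\<forall>x\<in>set (map f s). 0 < x"
        using pos sets by auto
    qed (use QR FX lens in simp_all)
    ultimately show ?thesis
      unfolding singular_stratum_def by (intro CollectI exI[of _ "\<lambda>j. f (\<sigma> j)"]) blast
  qed
  then have "F ` (stratum_tangent s \<inter> ball 0 (1/2)) \<subseteq> singular_stratum J k"
    by blast
  moreover have "C1_on (ball 0 (1/2)) F"
    using F(1) unfolding C1_on_def by (meson UNIV_I continuous_on_subset subset_UNIV)
  ultimately have "\<exists>M. M \<noteq> {} \<and> M \<subseteq> singular_stratum J k \<and>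
      C1_submanifold (dim (stratum_tangent s :: (real^'m^'n) set)) (M :: (real^'m^'n) set)"
    using F(2) by (intro C1_submanifold_image[where U = "ball 0 (1/2)"] subspace_stratum_tangent) auto
  then show ?thesis
    using that[OF inj s] by blast
qed

section \<open>Tangent vectors of the stratum\<close>

declare transpose_matrix_vector [simp del]

section \<open>Matrix limits, compactness of the orthogonal group, and products with diagonal
  matrices\<close>

lemma tendsto_matrix_mult:
  fixes f :: "'a \<Rightarrow> real^'m^'n" and g :: "'a \<Rightarrow> real^'k^'m"
  assumes "(f \<longlongrightarrow> A) F" "(g \<longlongrightarrow> B) F"
  shows "((\<lambda>x. f x ** g x) \<longlongrightarrow> A ** B) F"
  unfolding matrix_matrix_mult_def
  by (intro vec_tendstoI) (simp, intro tendsto_sum tendsto_mult tendsto_vec_nth assms)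

lemma tendsto_matrix_vector_mult:
  fixes f :: "'a \<Rightarrow> real^'m^'n" and g :: "'a \<Rightarrow> real^'m"
  assumes "(f \<longlongrightarrow> A) F" "(g \<longlongrightarrow> v) F"
  shows "((\<lambda>x. f x *v g x) \<longlongrightarrow> A *v v) F"
  unfolding matrix_vector_mult_def
  by (intro vec_tendstoI) (simp, intro tendsto_sum tendsto_mult tendsto_vec_nth assms)

lemma tendsto_transpose:
  fixes f :: "'a \<Rightarrow> real^'m^'n"
  assumes "(f \<longlongrightarrow> A) F"
  shows "((\<lambda>x. transpose (f x)) \<longlongrightarrow> transpose A) F"
  unfolding transpose_def
  by (intro vec_tendstoI) (simp, intro tendsto_vec_nth assms)

text \<open>Rows of norm 1 bound the sequence, so some subsequence converges, and
  \<open>U^T U = 1\<close> is preserved in the limit.\<close>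

lemma orthogonal_matrix_convergent_subsequence:
  fixes U :: "nat \<Rightarrow> real^'n^'n"
  assumes "\<And>i. orthogonal_matrix (U i)"
  obtains \<rho> P where "strict_mono \<rho>" "(U \<circ> \<rho>) \<longlonglongrightarrow> P" "orthogonal_matrix P"
proof -
  have "norm (U i) \<le> real CARD('n)" for i
  proof -
    have "norm (U i $ l) = 1" for l
      using assms[of i] unfolding orthogonal_matrix_orthonormal_rows by (simp add: row_def)
    moreover have "norm (U i) \<le> (\<Sum>l\<in>UNIV. norm (U i $ l))"
      unfolding norm_vec_def by (rule L2_set_le_sum) simp
    ultimately show ?thesis by simp
  qed
  then have "bounded (range U)"
    by (auto simp: bounded_iff)
  then obtain P \<rho> where \<rho>: "strict_mono (\<rho> :: nat \<Rightarrow> nat)" and P: "(U \<circ> \<rho>) \<longlonglongrightarrow> P"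
    using bounded_imp_convergent_subsequence by blast
  have "(\<lambda>i. transpose ((U \<circ> \<rho>) i) ** (U \<circ> \<rho>) i) \<longlonglongrightarrow> transpose P ** P"
    by (intro tendsto_matrix_mult tendsto_transpose P)
  moreover have "transpose ((U \<circ> \<rho>) i) ** (U \<circ> \<rho>) i = mat 1" for i
    using assms by (simp add: orthogonal_matrix)
  ultimately have "transpose P ** P = mat 1"
    by (simp only: LIMSEQ_const_iff)
  then have "orthogonal_matrix P"
    by (rule orthogonal_matrix[THEN iffD2])
  then show ?thesis
    using \<rho> P by (intro that[of \<rho> P])
qed

lemma orthogonal_matrix_cancel:
  assumes "orthogonal_matrix (Q :: real^'n^'n)"
  shows "transpose Q *v (Q *v v) = v" "Q *v (transpose Q *v v) = v"
    "transpose Q ** (Q ** A) = A" "Q ** (transpose Q ** A) = A"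
    "B ** transpose Q ** Q = B" "B ** Q ** transpose Q = B"
proof -
  have Q: "transpose Q ** Q = mat 1" "Q ** transpose Q = mat 1"
    using assms by (simp_all add: orthogonal_matrix_def)
  show "transpose Q *v (Q *v v) = v" "Q *v (transpose Q *v v) = v"
    by (simp_all only: matrix_vector_mul_assoc Q matrix_vector_mul_lid)
  show "transpose Q ** (Q ** A) = A" "Q ** (transpose Q ** A) = A"
    by (simp_all only: matrix_mul_assoc Q matrix_mul_lid)
  show "B ** transpose Q ** Q = B" "B ** Q ** transpose Q = B"
    by (simp_all only: matrix_mul_assoc[symmetric] Q matrix_mul_rid)
qed

lemma transpose_diag_mat: "transpose (diag_mat s :: real^'m^'n) = diag_mat s"
  by (auto simp: vec_eq_iff transpose_def diag_mat_def)

lemma diag_mat_vector_mult_nth: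
  assumes "length s \<le> CARD('m)"
  shows "((diag_mat s :: real^'m^'n) *v w) $ i = dg s (idx i) * w $ ix (idx i)"
proof -
  have "((diag_mat s :: real^'m^'n) *v w) $ i
      = (\<Sum>l\<in>UNIV. w $ l * (if idx l = idx i then dg s (idx i) else 0))"
    unfolding matrix_vector_mult_def by (auto simp: diag_mat_nth intro!: sum.cong)
  then show ?thesis
    using assms by (simp add: sum_idx_delta dg_def)
qed

lemma diag_mat_gram_nth:
  fixes w :: "real^'n"
  assumes "length s \<le> min CARD('n) CARD('m)"
  shows "((diag_mat s :: real^'m^'n) *v (transpose (diag_mat s :: real^'m^'n) *v w)) $ i = (dg s (idx i))\<^sup>2 * w $ i"
\<comment> \<open>Within the list, \<open>idx i\<close> is in range for both index types; beyond it
  both sides vanish.\<close>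
proof (cases "idx i < length s")
  case True
  then have "idx (ix (idx i) :: 'm) = idx i"
    using assms by simp
  then show ?thesis
    using assms by (simp add: diag_mat_vector_mult_nth transpose_diag_mat power2_eq_square)
next
  case False
  then show ?thesis
    using assms by (simp add: diag_mat_vector_mult_nth dg_def)
qed

text \<open>The factor \<open>V\<close> cancels in \<open>A A^T\<close>, so \<open>U\<close> carries
  eigenvectors of \<open>B B^T\<close> to eigenvectors of \<open>A A^T\<close>.\<close>

lemma gram_orthogonal_conj:
  fixes U :: "real^'n^'n" and V :: "real^'m^'m" and B :: "real^'m^'n"
  assumes "orthogonal_matrix U" "orthogonal_matrix V" "A = U ** B ** transpose V"
  shows "A *v (transpose A *v (U *v w)) = U *v (B *v (transpose B *v w))"
proof -
  have "transpose A = V ** transpose B ** transpose U"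
    by (simp add: assms(3) matrix_transpose_mul matrix_mul_assoc)
  then show ?thesis
    using orthogonal_matrix_cancel(1)[OF assms(1)] orthogonal_matrix_cancel(1)[OF assms(2)]
    by (simp add: assms(3) matrix_vector_mul_assoc[symmetric])
qed

text \<open>\<open>x ! a \<mapsto> y ! a\<close> is a well-defined surjection from \<open>set x\<close> to \<open>set y\<close>, hence injective if the
  cardinalities agree.\<close>

lemma list_pattern:
  assumes len: "length x = length y"
    and wd: "\<And>a b. a < length x \<Longrightarrow> b < length x \<Longrightarrow> x ! a = x ! b \<Longrightarrow> y ! a = y ! b"
  shows "card (set y) \<le> card (set x)"
    and "card (set x) \<le> card (set y) \<Longrightarrow> a < length x \<Longrightarrow> b < length x \<Longrightarrow> y ! a = y ! b \<Longrightarrow> x ! a = x ! b"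
proof -
  define h where "h v = y ! (SOME a. a < length x \<and> x ! a = v)" for v
  have h: "h (x ! a) = y ! a" if "a < length x" for a
  proof -
    have "(SOME b. b < length x \<and> x ! b = x ! a) < length x \<and> x ! (SOME b. b < length x \<and> x ! b = x ! a) = x ! a"
      by (rule someI[of _ a]) (simp add: that)
    then show ?thesis
      unfolding h_def using wd that by blast
  qed
  have img: "h ` set x = set y"
    using h len by (force simp: set_conv_nth image_iff)
  then show le: "card (set y) \<le> card (set x)"
    by (metis card_image_le List.finite_set)
  assume "card (set x) \<le> card (set y)" and ab: "a < length x" "b < length x" "y ! a = y ! b"
  then have "inj_on h (set x)"
    using le img by (intro eq_card_imp_inj_on) auto
  then show "x ! a = x ! b"
    using h ab by (metis inj_on_eq_iff nth_mem)
qed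

section \<open>First-order perturbation of singular values and singular vectors\<close>

text \<open>The orthogonal factors are assumed to converge here; the passage to subsequences follows
  afterwards. The constant number of distinct singular values prevents a multiple singular value of
  the limit from splitting along the sequence.\<close>

lemma tangent_of_convergent_svd:
  fixes A :: "nat \<Rightarrow> real^'m^'n" and s :: "real list"
  assumes len: "length s \<le> min CARD('n) CARD('m)" and pos: "\<And>x. x \<in> set s \<Longrightarrow> 0 < x"
    and svd: "\<And>i. is_svd (A i) (U i) (\<sigma> i) (V i)"
    and len\<sigma>: "\<And>i. length (\<sigma> i) = length s" and card\<sigma>: "\<And>i. card (set (\<sigma> i)) = card (set s)"
    and t: "\<And>i. t i > 0" and A: "A \<longlonglongrightarrow> diag_mat s"
    and X: "(\<lambda>i. (A i - diag_mat s) /\<^sub>R t i) \<longlonglongrightarrow> X"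
    and U: "U \<longlonglongrightarrow> P" "orthogonal_matrix P" and V: "V \<longlonglongrightarrow> R" "orthogonal_matrix R"
  shows "X \<in> stratum_tangent s"
proof -
  let ?D = "diag_mat s :: real^'m^'n"
  let ?r = "length s"
  note nm = len[unfolded min.bounded_iff, THEN conjunct1] len[unfolded min.bounded_iff, THEN conjunct2]
  have orth: "orthogonal_matrix (U i)" "orthogonal_matrix (V i)" for i
    using svd[of i] by (simp_all add: is_svd_def)
  have Aeq: "A i = U i ** diag_mat (\<sigma> i) ** transpose (V i)" for i
    using svd[of i] by (simp add: is_svd_def)
  have less: "a < CARD('n)" "a < CARD('m)" if "a < ?r" for a
    using that nm by auto
  define D' where "D' = transpose P ** ?D ** R"
  have "(\<lambda>i. transpose (U i) ** A i ** V i) \<longlonglongrightarrow> D'"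
    unfolding D'_def by (intro tendsto_matrix_mult tendsto_transpose A U(1) V(1))
  moreover have "transpose (U i) ** A i ** V i = diag_mat (\<sigma> i)" for i
    using orth(2)[of i] unfolding orthogonal_matrix_def
    by (simp only: Aeq matrix_mul_assoc[symmetric] orthogonal_matrix_cancel(3)[OF orth(1)] matrix_mul_rid)
  ultimately have lim: "(\<lambda>i. diag_mat (\<sigma> i) :: real^'m^'n) \<longlonglongrightarrow> D'"
    by simp
  \<comment> \<open>The limits of the singular values. They may come in another order than in
    \<open>s\<close>, and their positivity is known only after
    \<open>set s' = set s\<close>.\<close>
  define s' where "s' = map (\<lambda>a. D' $ ix a $ ix a) [0..<?r]"
  have len': "length s' = ?r" by (simp add: s'_def)
  have lim\<sigma>: "(\<lambda>i. \<sigma> i ! a) \<longlonglongrightarrow> s' ! a" if "a < ?r" for a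
  proof -
    have "(\<lambda>i. (diag_mat (\<sigma> i) :: real^'m^'n) $ ix a $ ix a) \<longlonglongrightarrow> D' $ ix a $ ix a"
      by (intro tendsto_vec_nth lim)
    then show ?thesis
      using that less[OF that] by (simp add: diag_mat_nth dg_def len\<sigma> s'_def)
  qed
  have "D' $ i $ j = diag_mat s' $ i $ j" for i j
  proof (rule LIMSEQ_unique)
    show "(\<lambda>l. (diag_mat (\<sigma> l) :: real^'m^'n) $ i $ j) \<longlonglongrightarrow> D' $ i $ j"
      by (intro tendsto_vec_nth lim)
    show "(\<lambda>l. (diag_mat (\<sigma> l) :: real^'m^'n) $ i $ j) \<longlonglongrightarrow> diag_mat s' $ i $ j"
      using lim\<sigma>[of "idx j"] by (auto simp: diag_mat_nth dg_def len\<sigma> len')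
  qed
  then have D': "D' = diag_mat s'"
    by (simp add: vec_eq_iff)
  have Deq: "?D = P ** diag_mat s' ** transpose R"
    unfolding D'[symmetric] D'_def
    using V(2) unfolding orthogonal_matrix_def
    by (simp only: matrix_mul_assoc[symmetric] orthogonal_matrix_cancel(4)[OF U(2)] matrix_mul_rid)
  have nonneg: "0 \<le> s' ! a" if "a < ?r" for a
  proof (rule LIMSEQ_le_const[OF lim\<sigma>[OF that]])
    have "0 \<le> \<sigma> i ! a" for i
      using svd[of i] that by (auto simp: is_svd_def len\<sigma> less_imp_le)
    then show "\<exists>N. \<forall>i\<ge>N. 0 \<le> \<sigma> i ! a" by blast
  qed
  note gram = diag_mat_gram_nth[where 'n = 'n and 'm = 'm]
  \<comment> \<open>The basis vector is an eigenvector of \<open>D D^T\<close> with eigenvalue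
    \<open>(s ! a)\<^sup>2\<close>; in the basis given by \<open>P\<close> the matrix
    \<open>D D^T\<close> is diagonal with the squares of \<open>s'\<close>.\<close>
  have eigen: "(dg s' (idx i))\<^sup>2 * (transpose P *v axis (ix a) 1) $ i = (s ! a)\<^sup>2 * (transpose P *v axis (ix a) 1) $ i"
    if a: "a < ?r" for a i
  proof -
    let ?e = "axis (ix a) 1 :: real^'n"
    let ?w = "transpose P *v ?e"
    have "(?D *v (transpose ?D *v ?e)) $ l = ((s ! a)\<^sup>2 *\<^sub>R ?e) $ l" for l
      using a less[OF a] gram[OF len, of ?e l] by (simp add: axis_def dg_def)
    then have "?D *v (transpose ?D *v ?e) = (s ! a)\<^sup>2 *\<^sub>R ?e"
      by (simp only: vec_eq_iff) blast
    moreover have "?D *v (transpose ?D *v (P *v ?w)) = P *v (diag_mat s' *v (transpose (diag_mat s' :: real^'m^'n) *v ?w))"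
      by (rule gram_orthogonal_conj[OF U(2) V(2) Deq])
    ultimately have "P *v (diag_mat s' *v (transpose (diag_mat s' :: real^'m^'n) *v ?w)) = (s ! a)\<^sup>2 *\<^sub>R ?e"
      by (simp add: orthogonal_matrix_cancel[OF U(2)])
    then have "transpose P *v (P *v (diag_mat s' *v (transpose (diag_mat s' :: real^'m^'n) *v ?w))) = (s ! a)\<^sup>2 *\<^sub>R ?w"
      by (simp add: matrix_vector_mult_scaleR)
    then have "diag_mat s' *v (transpose (diag_mat s' :: real^'m^'n) *v ?w) = (s ! a)\<^sup>2 *\<^sub>R ?w"
      by (simp add: orthogonal_matrix_cancel[OF U(2)])
    then have "(diag_mat s' *v (transpose (diag_mat s' :: real^'m^'n) *v ?w)) $ i = (s ! a)\<^sup>2 * ?w $ i"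
      by simp
    moreover have "(diag_mat s' *v (transpose (diag_mat s' :: real^'m^'n) *v ?w)) $ i = (dg s' (idx i))\<^sup>2 * ?w $ i"
      by (rule gram) (simp only: len len')
    ultimately show ?thesis by (rule trans[OF sym, rotated])
  qed
  have support: "idx i < ?r \<and> s' ! idx i = s ! a"
    if a: "a < ?r" and nz: "(transpose P *v axis (ix a) 1) $ i \<noteq> 0" for a i
  proof -
    have "0 < s ! a" using pos a by simp
    moreover have "0 \<le> dg s' (idx i)" using nonneg by (simp add: dg_def len')
    ultimately have "dg s' (idx i) = s ! a"
      using eigen[OF a, of i] nz by (simp add: power2_eq_iff_nonneg)
    then show ?thesis
      using \<open>0 < s ! a\<close> by (auto simp: dg_def len' split: if_splits)
  qed
  have "set s \<subseteq> set s'"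
  proof
    fix v assume "v \<in> set s"
    then obtain a where a: "a < ?r" "v = s ! a" by (auto simp: in_set_conv_nth)
    have "transpose P *v axis (ix a) 1 \<noteq> 0"
    proof
      assume "transpose P *v axis (ix a) 1 = 0"
      then have "axis (ix a) 1 = (0 :: real^'n)"
        using orthogonal_matrix_cancel(2)[OF U(2), of "axis (ix a) 1"] by simp
      then show False by (simp add: axis_eq_0_iff)
    qed
    then obtain i where "(transpose P *v axis (ix a) 1) $ i \<noteq> 0"
      by (auto simp: vec_eq_iff)
    from support[OF a(1) this] show "v \<in> set s'"
      using a(2) nth_mem[of "idx i" s'] by (simp add: len')
  qed
  \<comment> \<open>Distinct limits separate the values eventually, so eventually equal entries of
    \<open>\<sigma> i\<close> have equal limits.\<close>
  have ev1: "\<forall>\<^sub>F i in sequentially. \<forall>a\<in>{..<?r}. \<forall>b\<in>{..<?r}. s' ! a \<noteq> s' ! b \<longrightarrow> \<sigma> i ! a \<noteq> \<sigma> i ! b"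
  proof (intro eventually_ball_finite ballI finite_lessThan)
    fix a b assume ab: "a \<in> {..<?r}" "b \<in> {..<?r}"
    show "\<forall>\<^sub>F i in sequentially. s' ! a \<noteq> s' ! b \<longrightarrow> \<sigma> i ! a \<noteq> \<sigma> i ! b"
    proof (cases "s' ! a = s' ! b")
      case False
      have "(\<lambda>i. \<sigma> i ! a - \<sigma> i ! b) \<longlonglongrightarrow> s' ! a - s' ! b"
        using ab by (intro tendsto_diff lim\<sigma>) auto
      then have "\<forall>\<^sub>F i in sequentially. \<sigma> i ! a - \<sigma> i ! b \<noteq> 0"
        by (rule tendsto_imp_eventually_ne) (use False in simp)
      then show ?thesis by eventually_elim auto
    qed simp
  qed
  then have wd: "\<forall>\<^sub>F i in sequentially. \<forall>a b. a < length (\<sigma> i) \<longrightarrow> b < length (\<sigma> i) \<longrightarrow> \<sigma> i ! a = \<sigma> i ! b \<longrightarrow> s' ! a = s' ! b"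
    by eventually_elim (use len\<sigma> in auto)
  then obtain i0 where i0: "\<forall>a b. a < length (\<sigma> i0) \<longrightarrow> b < length (\<sigma> i0) \<longrightarrow> \<sigma> i0 ! a = \<sigma> i0 ! b \<longrightarrow> s' ! a = s' ! b"
    unfolding eventually_sequentially by blast
  \<comment> \<open>So \<open>s'\<close> has at most as many distinct values as \<open>s\<close>,
    and it contains all of those.\<close>
  have "card (set s') \<le> card (set (\<sigma> i0))"
    by (rule list_pattern(1)[OF _ i0[rule_format]]) (simp_all only: len\<sigma> len')
  then have set_eq: "set s' = set s"
    using card_seteq[OF List.finite_set \<open>set s \<subseteq> set s'\<close>] card\<sigma> by simp
  \<comment> \<open>The map from values of \<open>\<sigma> i\<close> to their limits is onto a set
    of the same size, hence injective: entries with a common limit are eventually equal.\<close>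
  have coalesce: "\<forall>\<^sub>F i in sequentially. \<forall>a<?r. \<forall>b<?r. s' ! a = s' ! b \<longrightarrow> \<sigma> i ! a = \<sigma> i ! b"
    using wd
  proof eventually_elim
    case (elim i)
    have "\<sigma> i ! a = \<sigma> i ! b" if "a < ?r" "b < ?r" "s' ! a = s' ! b" for a b
      by (rule list_pattern(2)[OF _ elim[rule_format] _ _ _ that(3)])
        (simp_all only: len\<sigma> len' card\<sigma> set_eq that order_refl)
    then show ?case by blast
  qed
  have pos': "0 < s' ! a" if "a < ?r" for a
    using that nth_mem[of a s'] by (intro pos) (simp add: len' set_eq)
  show ?thesis
  proof (rule stratum_tangentI)
    fix i0 :: 'n and j0 :: 'm assume i0: "?r \<le> idx i0" and j0: "?r \<le> idx j0"
    \<comment> \<open>Since \<open>?e\<close> is in the kernel of \<open>D\<close>, its coordinates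
      \<open>w\<close> vanish where \<open>s'\<close> is positive. So \<open>V i *v w\<close> is in
      the kernel of \<open>A i\<close> and tends to \<open>?e\<close>. Row \<open>i0\<close> of
      \<open>D\<close> is zero, so this row of the difference quotient annihilates
      \<open>V i *v w\<close>.\<close>
    let ?e = "axis j0 1 :: real^'m"
    define w where "w = transpose R *v ?e"
    have Rw: "R *v w = ?e"
      by (simp add: w_def orthogonal_matrix_cancel[OF V(2)])
    have "?D *v ?e = 0"
      using j0 nm by (simp add: vec_eq_iff diag_mat_vector_mult_nth axis_def dg_def) (metis idx_ix not_le order_less_le_trans)
    moreover have "?D *v ?e = P *v (diag_mat s' *v w)"
      by (simp add: Deq w_def matrix_vector_mul_assoc matrix_mul_assoc)
    ultimately have "(diag_mat s' :: real^'m^'n) *v w = 0"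
      using orthogonal_matrix_cancel(1)[OF U(2), of "diag_mat s' *v w"] by simp
    then have 0: "((diag_mat s' :: real^'m^'n) *v w) $ i = 0" for i
      by simp
    have w0: "w $ ix a = 0" if "a < ?r" for a
    proof -
      have "((diag_mat s' :: real^'m^'n) *v w) $ ix a = s' ! a * w $ ix a"
        using that less[OF that] nm by (simp add: diag_mat_vector_mult_nth len' dg_def)
      then show ?thesis
        using 0[of "ix a"] pos'[OF that] by simp
    qed
    have "(diag_mat (\<sigma> i) :: real^'m^'n) *v w = 0" for i
      using nm w0 by (simp add: vec_eq_iff diag_mat_vector_mult_nth len\<sigma> dg_def)
    then have "A i *v (V i *v w) = 0" for i
      by (simp add: Aeq matrix_vector_mul_assoc[symmetric] orthogonal_matrix_cancel[OF orth(2)])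
    moreover have "(?D *v x) $ i0 = 0" for x
      using i0 nm by (simp add: diag_mat_vector_mult_nth dg_def)
    ultimately have "(((A i - ?D) /\<^sub>R t i) *v (V i *v w)) $ i0 = 0" for i
      by (simp add: scaleR_matrix_vector_assoc[symmetric] matrix_vector_mult_diff_rdistrib)
    moreover have "(\<lambda>i. (((A i - ?D) /\<^sub>R t i) *v (V i *v w)) $ i0) \<longlonglongrightarrow> (X *v (R *v w)) $ i0"
      by (intro tendsto_vec_nth tendsto_matrix_vector_mult X V(1) tendsto_const)
    ultimately have "(X *v ?e) $ i0 = 0"
      unfolding Rw by (simp add: LIMSEQ_const_iff)
    then show "X $ i0 $ j0 = 0"
      by (simp add: matrix_vector_mult_basis column_def)
  next
    \<comment> \<open>\<open>q\<close> is the difference quotient of the squared singular value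
      belonging to \<open>v\<close>. It is the same for all positions \<open>a\<close> of the block,
      so uniqueness of its limit will force equal diagonal entries of \<open>X\<close>.\<close>
    have key: "\<exists>q :: nat \<Rightarrow> real. \<forall>a<?r. s ! a = v \<longrightarrow> q \<longlonglongrightarrow> 2 * v * X $ ix a $ ix a \<and>
        (\<forall>b<?r. s ! b = v \<longrightarrow> a \<noteq> b \<longrightarrow> X $ ix a $ ix b + X $ ix b $ ix a = 0)" if v: "v \<in> set s" for v
    proof -
      obtain c where c: "c < ?r" "s' ! c = v"
        using v unfolding set_eq[symmetric] by (auto simp: in_set_conv_nth len')
      define q where "q i = ((\<sigma> i ! c)\<^sup>2 - v\<^sup>2) / t i" for i
      have vpos: "0 < v" using v by (rule pos)
      \<comment> \<open>Coordinate \<open>ix b\<close> of the eigenvalue equation of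
        \<open>A A^T\<close> at \<open>U i *v w\<close>, minus that of \<open>D D^T\<close>, divided
        by \<open>t i\<close>; here
        \<open>A A^T - D D^T = (A - D) A^T + D (A - D)^T\<close>.\<close>
      have *: "\<forall>\<^sub>F i in sequentially. q i * (U i *v (transpose P *v axis (ix a) 1)) $ ix b =
          ((((A i - ?D) /\<^sub>R t i) ** transpose (A i) + ?D ** transpose ((A i - ?D) /\<^sub>R t i))
            *v (U i *v (transpose P *v axis (ix a) 1))) $ ix b"
        if a: "a < ?r" "s ! a = v" and b: "b < ?r" "s ! b = v" for a b
        using coalesce
      proof eventually_elim
        case (elim i)
        let ?w = "transpose P *v axis (ix a) 1 :: real^'n"
        let ?z = "U i *v ?w"
        \<comment> \<open>\<open>?w\<close> is supported where \<open>s'\<close> equals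
          \<open>v\<close>, and there all entries of \<open>\<sigma> i\<close> coincide by
          \<open>coalesce\<close>.\<close>
        have "((diag_mat (\<sigma> i) :: real^'m^'n) *v (transpose (diag_mat (\<sigma> i) :: real^'m^'n) *v ?w)) $ l = ((\<sigma> i ! c)\<^sup>2 *\<^sub>R ?w) $ l" for l
        proof (cases "?w $ l = 0")
          case True
          then show ?thesis using gram[of "\<sigma> i" ?w l] len len\<sigma> by simp
        next
          case False
          from support[OF a(1) this] have l: "idx l < ?r" "s' ! idx l = s' ! c"
            using a(2) c(2) by auto
          then have "\<sigma> i ! idx l = \<sigma> i ! c"
            using elim[rule_format, OF l(1) c(1) l(2)] by simp
          then show ?thesis using gram[of "\<sigma> i" ?w l] l(1) len len\<sigma> by (simp add: dg_def)
        qed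
        then have "(diag_mat (\<sigma> i) :: real^'m^'n) *v (transpose (diag_mat (\<sigma> i) :: real^'m^'n) *v ?w) = (\<sigma> i ! c)\<^sup>2 *\<^sub>R ?w"
          by (simp only: vec_eq_iff) blast
        then have "A i *v (transpose (A i) *v ?z) = (\<sigma> i ! c)\<^sup>2 *\<^sub>R ?z"
          by (simp add: gram_orthogonal_conj[OF orth Aeq] matrix_vector_mult_scaleR)
        moreover have "(?D *v (transpose ?D *v ?z)) $ ix b = v\<^sup>2 * ?z $ ix b"
          using gram[OF len, of ?z "ix b"] b less[OF b(1)] by (simp add: dg_def)
        moreover have "((A i - ?D) /\<^sub>R t i) ** transpose (A i) + ?D ** transpose ((A i - ?D) /\<^sub>R t i)
            = (A i ** transpose (A i) - ?D ** transpose ?D) /\<^sub>R t i"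
        proof -
          have "transpose ((A i - ?D) /\<^sub>R t i) = (transpose (A i) - transpose ?D) /\<^sub>R t i"
            by (simp add: vec_eq_iff transpose_def)
          moreover have "(x *\<^sub>R B) ** C = x *\<^sub>R (B ** C)" "E ** (x *\<^sub>R F) = x *\<^sub>R (E ** F)"
            for x and B E :: "real^'m^'n" and C F :: "real^'n^'m"
            by (simp_all add: vec_eq_iff matrix_matrix_mult_def sum_distrib_left mult_ac)
          ultimately show ?thesis
            by (simp add: matrix_diff_ldistrib matrix_diff_rdistrib scaleR_add_right[symmetric])
        qed
        ultimately show ?case
          by (simp add: scaleR_matrix_vector_assoc[symmetric] matrix_vector_mult_diff_rdistrib
              matrix_vector_mul_assoc[symmetric] q_def)
            (simp add: divide_simps left_diff_distrib)
      qed
      have lim1: "(\<lambda>i. (U i *v (transpose P *v axis (ix a) 1)) $ ix b) \<longlonglongrightarrow> (if a = b then 1 else 0)"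
        if "a < ?r" "b < ?r" for a b
      proof -
        have "(\<lambda>i. (U i *v (transpose P *v axis (ix a) 1)) $ ix b) \<longlonglongrightarrow> (P *v (transpose P *v axis (ix a) 1)) $ ix b"
          by (intro tendsto_vec_nth tendsto_matrix_vector_mult U(1) tendsto_const)
        moreover have "(ix a :: 'n) = ix b \<longleftrightarrow> a = b"
          using less that by (metis idx_ix)
        ultimately show ?thesis
          by (simp add: orthogonal_matrix_cancel[OF U(2)] axis_def eq_commute)
      qed
      have lim2: "(\<lambda>i. q i * (U i *v (transpose P *v axis (ix a) 1)) $ ix b) \<longlonglongrightarrow> v * (X $ ix a $ ix b + X $ ix b $ ix a)"
        if a: "a < ?r" "s ! a = v" and b: "b < ?r" "s ! b = v" for a b
      proof -
        have "(\<lambda>i. ((((A i - ?D) /\<^sub>R t i) ** transpose (A i) + ?D ** transpose ((A i - ?D) /\<^sub>R t i))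
            *v (U i *v (transpose P *v axis (ix a) 1))) $ ix b)
          \<longlonglongrightarrow> ((X ** transpose ?D + ?D ** transpose X) *v (P *v (transpose P *v axis (ix a) 1))) $ ix b"
          by (intro tendsto_vec_nth tendsto_matrix_vector_mult tendsto_add tendsto_matrix_mult
              tendsto_transpose U(1) A X tendsto_const)
        moreover have "((X ** transpose ?D + ?D ** transpose X) *v (P *v (transpose P *v axis (ix a) 1))) $ ix b
            = v * (X $ ix a $ ix b + X $ ix b $ ix a)"
        proof -
          have "((X ** transpose ?D + ?D ** transpose X) *v (P *v (transpose P *v axis (ix a) 1))) $ ix b
              = (X ** transpose ?D + ?D ** transpose X) $ ix b $ ix a"
            unfolding orthogonal_matrix_cancel(2)[OF U(2)] by (simp add: matrix_vector_mult_basis column_def)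
          also have "\<dots> = v * (X $ ix a $ ix b + X $ ix b $ ix a)"
            using a b less[OF a(1)] less[OF b(1)] nm
            by (simp add: transpose_diag_mat matrix_mult_diag_mat_nth diag_mat_mult_matrix_nth dg_def
                transpose_def[of X] algebra_simps)
          finally show ?thesis .
        qed
        moreover have "\<forall>\<^sub>F i in sequentially.
            ((((A i - ?D) /\<^sub>R t i) ** transpose (A i) + ?D ** transpose ((A i - ?D) /\<^sub>R t i))
              *v (U i *v (transpose P *v axis (ix a) 1))) $ ix b
            = q i * (U i *v (transpose P *v axis (ix a) 1)) $ ix b"
          using *[OF a b] by eventually_elim (rule sym)
        ultimately show ?thesis
          by (simp only: tendsto_cong)
      qed
      \<comment> \<open>For \<open>a = b\<close> the vector coordinate tends to 1 and may be divided
        out. For \<open>a \<noteq> b\<close> it tends to 0 while \<open>q\<close> converges, so the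
        symmetric part of \<open>X\<close> vanishes there.\<close>
      have q: "q \<longlonglongrightarrow> 2 * v * X $ ix a $ ix a" if a: "a < ?r" "s ! a = v" for a
      proof -
        have "(\<lambda>i. q i * (U i *v (transpose P *v axis (ix a) 1)) $ ix a / (U i *v (transpose P *v axis (ix a) 1)) $ ix a)
            \<longlonglongrightarrow> v * (X $ ix a $ ix a + X $ ix a $ ix a) / 1"
          using lim1[OF a(1) a(1)] by (intro tendsto_divide lim2 a) auto
        moreover have "\<forall>\<^sub>F i in sequentially. (U i *v (transpose P *v axis (ix a) 1)) $ ix a \<noteq> 0"
          using lim1[OF a(1) a(1)] by (intro tendsto_imp_eventually_ne[where c = 1]) auto
        then have "\<forall>\<^sub>F i in sequentially. q i * (U i *v (transpose P *v axis (ix a) 1)) $ ix a / (U i *v (transpose P *v axis (ix a) 1)) $ ix a = q i"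
          by eventually_elim simp
        ultimately have "q \<longlonglongrightarrow> v * (X $ ix a $ ix a + X $ ix a $ ix a) / 1"
          by (rule Lim_transform_eventually)
        then show ?thesis by (simp add: algebra_simps)
      qed
      have "X $ ix a $ ix b + X $ ix b $ ix a = 0"
        if a: "a < ?r" "s ! a = v" and b: "b < ?r" "s ! b = v" and "a \<noteq> b" for a b
      proof -
        have "(\<lambda>i. q i * (U i *v (transpose P *v axis (ix a) 1)) $ ix b) \<longlonglongrightarrow> 2 * v * X $ ix a $ ix a * 0"
          using lim1[OF a(1) b(1)] \<open>a \<noteq> b\<close> by (intro tendsto_mult q a) auto
        from LIMSEQ_unique[OF lim2[OF a b] this] show ?thesis
          using vpos by simp
      qed
      with q show ?thesis by (intro exI[of _ q]) blast
    qed
    fix a b assume ab: "a < ?r" "b < ?r" "s ! a = s ! b"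
    then obtain q where q: "\<And>c. c < ?r \<Longrightarrow> s ! c = s ! a \<Longrightarrow> q \<longlonglongrightarrow> 2 * s ! a * X $ ix c $ ix c"
      and "a \<noteq> b \<Longrightarrow> X $ ix a $ ix b + X $ ix b $ ix a = 0"
      using key[of "s ! a"] by (metis nth_mem)
    then show "a \<noteq> b \<Longrightarrow> X $ ix a $ ix b + X $ ix b $ ix a = 0"
      by blast
    show "X $ ix a $ ix a = X $ ix b $ ix b"
      using LIMSEQ_unique[OF q[OF ab(1) refl] q[OF ab(2) ab(3)[symmetric]]] pos[OF nth_mem[OF ab(1)]] by simp
  qed
qed

text \<open>A subsequence is chosen first for \<open>U\<close>, then a further one for
  \<open>V\<close>; all other assumptions pass to subsequences.\<close>

lemma tangent_of_svd:
  fixes A :: "nat \<Rightarrow> real^'m^'n" and s :: "real list"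
  assumes len: "length s \<le> min CARD('n) CARD('m)" and pos: "\<And>x. x \<in> set s \<Longrightarrow> 0 < x"
    and svd: "\<And>i. is_svd (A i) (U i) (\<sigma> i) (V i)"
    and len\<sigma>: "\<And>i. length (\<sigma> i) = length s" and card\<sigma>: "\<And>i. card (set (\<sigma> i)) = card (set s)"
    and t: "\<And>i. t i > 0" and A: "A \<longlonglongrightarrow> diag_mat s"
    and X: "(\<lambda>i. (A i - diag_mat s) /\<^sub>R t i) \<longlonglongrightarrow> X"
  shows "X \<in> stratum_tangent s"
proof -
  have orth: "orthogonal_matrix (U i)" "orthogonal_matrix (V i)" for i
    using svd[of i] by (simp_all add: is_svd_def)
  obtain \<rho> P where \<rho>: "strict_mono \<rho>" and P: "(U \<circ> \<rho>) \<longlonglongrightarrow> P" "orthogonal_matrix P"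
    by (rule orthogonal_matrix_convergent_subsequence[OF orth(1)])
  have orth\<rho>: "orthogonal_matrix ((V \<circ> \<rho>) i)" for i
    using orth(2) by simp
  obtain \<tau> R where \<tau>: "strict_mono \<tau>" and R: "((V \<circ> \<rho>) \<circ> \<tau>) \<longlonglongrightarrow> R" "orthogonal_matrix R"
    by (rule orthogonal_matrix_convergent_subsequence[OF orth\<rho>])
  have \<mu>: "strict_mono (\<rho> \<circ> \<tau>)"
    by (rule strict_mono_o[OF \<rho> \<tau>])
  have U: "(\<lambda>i. U (\<rho> (\<tau> i))) \<longlonglongrightarrow> P" and V: "(\<lambda>i. V (\<rho> (\<tau> i))) \<longlonglongrightarrow> R"
    using LIMSEQ_subseq_LIMSEQ[OF P(1) \<tau>] R(1) unfolding comp_def .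
  show ?thesis
    using tangent_of_convergent_svd[OF len pos svd len\<sigma> card\<sigma> t
        LIMSEQ_subseq_LIMSEQ[OF A \<mu>, unfolded comp_def]
        LIMSEQ_subseq_LIMSEQ[OF X \<mu>, unfolded comp_def] U P(2) V R(2)] .
qed

lemma singular_stratum_svd:
  fixes A :: "real^'m^'n"
  assumes "A \<in> singular_stratum J k"
  obtains U s V \<sigma> where "is_svd A U s V" "inj_on \<sigma> {1..J}"
    "mset s = (\<Sum>j=1..J. replicate_mset (k j) (\<sigma> j))"
proof -
  obtain \<sigma> :: "nat \<Rightarrow> real" where \<sigma>: "\<forall>i\<in>{1..J}. \<forall>j\<in>{1..J}. i < j \<longrightarrow> \<sigma> i > \<sigma> j"
    and "has_singular_values A (\<Sum>j=1..J. replicate_mset (k j) (\<sigma> j))"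
    using assms unfolding singular_stratum_def by blast
  then obtain U s V where svd: "is_svd A U s V" and s: "(\<Sum>j=1..J. replicate_mset (k j) (\<sigma> j)) = mset s"
    unfolding has_singular_values_def by blast
  have "inj_on \<sigma> {1..J}"
  proof (rule inj_onI)
    fix i j assume "i \<in> {1..J}" "j \<in> {1..J}" "\<sigma> i = \<sigma> j"
    then show "i = j"
      using \<sigma> by (cases i j rule: linorder_cases) force+
  qed
  then show ?thesis
    by (rule that[OF svd _ s[symmetric]])
qed

section \<open>The upper bound for the dimension\<close>

text \<open>The linear bijection \<open>G\<close> preserves singular values and moves the point
  \<open>x\<close> to \<open>diag_mat s\<close>, so \<open>G \<circ> D\<close> embeds the model
  space \<open>L\<close> into the tangent space there. The list \<open>s\<close> depends on
  \<open>x\<close>.\<close>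

lemma singular_stratum_submanifold_dim_le:
  fixes J r :: nat and k :: "nat \<Rightarrow> nat" and M :: "(real^'m^'n) set"
  assumes k: "\<And>j. j \<in> {1..J} \<Longrightarrow> k j > 0" and r: "r = (\<Sum>j=1..J. k j)"
    and len: "r \<le> min CARD('n::finite) CARD('m::finite)"
    and M: "M \<noteq> {}" "M \<subseteq> singular_stratum J k" "C1_submanifold d M"
  obtains s \<sigma> where "inj_on \<sigma> {1..J}" "mset s = (\<Sum>j=1..J. replicate_mset (k j) (\<sigma> j))"
    "d \<le> dim (stratum_tangent s :: (real^'m^'n) set)"
proof -
  obtain x where x: "x \<in> M" using M(1) by blast
  obtain U0 s V0 \<sigma> where svd0: "is_svd x U0 s V0" and inj: "inj_on \<sigma> {1..J}"
    and s: "mset s = (\<Sum>j=1..J. replicate_mset (k j) (\<sigma> j))"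
    by (rule singular_stratum_svd[OF subsetD[OF M(2) x]])
  have orth0: "orthogonal_matrix U0" "orthogonal_matrix V0" and xeq: "x = U0 ** diag_mat s ** transpose V0"
    and pos: "\<And>v. v \<in> set s \<Longrightarrow> 0 < v"
    using svd0 by (auto simp: is_svd_def)
  obtain D :: "real^'m^'n \<Rightarrow> real^'m^'n" and L where D: "linear D" and L: "subspace L" "dim L = d" and injD: "inj D"
    and curve: "\<forall>h\<in>L. \<exists>c t. (\<forall>i::nat. c i \<in> M \<and> t i > (0::real)) \<and> t \<longlonglongrightarrow> 0 \<and> c \<longlonglongrightarrow> x \<and>
       (\<lambda>i. (c i - x) /\<^sub>R t i) \<longlonglongrightarrow> D h"
    by (rule C1_submanifold_tangent[OF M(3) x])
  define G :: "real^'m^'n \<Rightarrow> real^'m^'n" where "G Y = transpose U0 ** Y ** V0" for Y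
  have G: "linear G"
  proof (rule linearI)
    show "G (Y + Z) = G Y + G Z" for Y Z
      by (simp add: G_def matrix_add_ldistrib matrix_add_rdistrib)
    show "G (c *\<^sub>R Y) = c *\<^sub>R G Y" for c Y
    proof -
      have "transpose U0 ** (c *\<^sub>R Y) = c *\<^sub>R (transpose U0 ** Y)"
        by (simp add: vec_eq_iff matrix_matrix_mult_def sum_distrib_left mult.left_commute)
      moreover have "(c *\<^sub>R Z) ** V0 = c *\<^sub>R (Z ** V0)" for Z :: "real^'m^'n"
        by (simp add: vec_eq_iff matrix_matrix_mult_def sum_distrib_left mult.assoc)
      ultimately show ?thesis by (simp add: G_def)
    qed
  qed
  have V0: "V0 ** transpose V0 = mat 1" "transpose V0 ** V0 = mat 1"
    using orth0(2) by (simp_all add: orthogonal_matrix_def)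
  have Ginv: "U0 ** G Y ** transpose V0 = Y" for Y
    by (simp only: G_def matrix_mul_assoc[symmetric] orthogonal_matrix_cancel(4)[OF orth0(1)] V0 matrix_mul_rid)
  have Gx: "G x = diag_mat s"
    by (simp only: G_def xeq matrix_mul_assoc[symmetric] orthogonal_matrix_cancel(3)[OF orth0(1)] V0 matrix_mul_rid)
  have "G (D h) \<in> stratum_tangent s" if h: "h \<in> L" for h
  proof -
    obtain c and t :: "nat \<Rightarrow> real" where c: "\<And>i. c i \<in> M" and t: "\<And>i. t i > 0" and lim: "c \<longlonglongrightarrow> x"
      "(\<lambda>i. (c i - x) /\<^sub>R t i) \<longlonglongrightarrow> D h"
      using bspec[OF curve h] by blast
    have "\<exists>U u V. is_svd (G (c i)) U u V \<and> length u = r \<and> card (set u) = J" for i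
    proof -
      obtain U u V \<tau> where svd: "is_svd (c i) U u V" and \<tau>: "inj_on \<tau> {1..J}"
        "mset u = (\<Sum>j=1..J. replicate_mset (k j) (\<tau> j))"
        by (rule singular_stratum_svd[OF subsetD[OF M(2) c]])
      have "is_svd (G (c i)) (transpose U0 ** U) u (transpose V0 ** V)"
        unfolding is_svd_def
      proof (intro conjI)
        show "orthogonal_matrix (transpose U0 ** U)" "orthogonal_matrix (transpose V0 ** V)"
          using svd orth0 by (simp_all add: is_svd_def orthogonal_matrix_mul)
        show "G (c i) = transpose U0 ** U ** diag_mat u ** transpose (transpose V0 ** V)"
          using svd by (simp add: is_svd_def G_def matrix_transpose_mul matrix_mul_assoc)
      qed (use svd in \<open>simp_all add: is_svd_def\<close>)
      then show ?thesis
        using dim_stratum_tangent(1)[OF k r len \<tau>] dim_stratum_tangent(2)[OF k r len \<tau>]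
        by (intro exI conjI)
    qed
    then obtain U u V where u: "\<And>i. is_svd (G (c i)) (U i) (u i) (V i)" "\<And>i. length (u i) = r" "\<And>i. card (set (u i)) = J"
      by metis
    have lims: "length s = r" "card (set s) = J"
      using dim_stratum_tangent(1,2)[OF k r len inj s] by auto
    show ?thesis
    proof (rule tangent_of_svd[OF _ pos u(1)])
      show "(\<lambda>i. G (c i)) \<longlonglongrightarrow> diag_mat s"
        unfolding Gx[symmetric] G_def by (intro tendsto_matrix_mult tendsto_const lim(1))
      have "(\<lambda>i. G ((c i - x) /\<^sub>R t i)) \<longlonglongrightarrow> G (D h)"
        unfolding G_def by (intro tendsto_matrix_mult tendsto_const lim(2))
      then show "(\<lambda>i. (G (c i) - diag_mat s) /\<^sub>R t i) \<longlonglongrightarrow> G (D h)"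
        by (simp add: linear_cmul[OF G] linear_diff[OF G] Gx)
    qed (use u lims len t in simp_all)
  qed
  then have "(G \<circ> D) ` L \<subseteq> stratum_tangent s"
    by auto
  then have "dim ((G \<circ> D) ` L) \<le> dim (stratum_tangent s :: (real^'m^'n) set)"
    by (rule dim_subset)
  moreover have "inj G"
    by (rule inj_on_inverseI[where g = "\<lambda>Z. U0 ** Z ** transpose V0"]) (rule Ginv)
  then have "inj (G \<circ> D)"
    using injD by (rule inj_compose)
  then have "dim ((G \<circ> D) ` L) = dim L"
    by (rule dim_image_eq[OF linear_compose[OF D G] inj_on_subset[OF _ subset_UNIV]])
  ultimately show ?thesis
    using L(2) by (intro that[OF inj s]) simp
qed

theorem corollary9p1:
  fixes J r :: nat and k :: "nat \<Rightarrow> nat"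
  assumes "\<And>j. j \<in> {1..J} \<Longrightarrow> k j > 0"
    and "r = (\<Sum>j=1..J. k j)"
    and "r \<le> min CARD('n::finite) CARD('m::finite)"
  shows "real (real_dim (singular_stratum J k :: (real^'m^'n) set)) =
    (real CARD('n) + real CARD('m) - real r) * real r - real r
      - 1 / 2 * (\<Sum>j=1..J. real (k j) * (real (k j) - 1)) + real J"
proof -
  have dim: "real (dim (stratum_tangent u :: (real^'m^'n) set)) =
    (real CARD('n) + real CARD('m) - real r) * real r - real r
      - 1 / 2 * (\<Sum>j=1..J. real (k j) * (real (k j) - 1)) + real J"
    if "inj_on \<tau> {1..J}" "mset u = (\<Sum>j=1..J. replicate_mset (k j) (\<tau> j))" for u \<tau>
    by (rule dim_stratum_tangent(3)[OF assms that])
  obtain s \<sigma> and M :: "(real^'m^'n) set" where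
    s: "inj_on \<sigma> {1..J}" "mset s = (\<Sum>j=1..J. replicate_mset (k j) (\<sigma> j))"
    and M: "M \<noteq> {}" "M \<subseteq> singular_stratum J k"
      "C1_submanifold (dim (stratum_tangent s :: (real^'m^'n) set)) M"
    by (rule singular_stratum_submanifold[OF assms])
  have "real_dim (singular_stratum J k :: (real^'m^'n) set) = dim (stratum_tangent s :: (real^'m^'n) set)"
    unfolding real_dim_def
  proof (rule Greatest_equality)
    show "\<exists>M. M \<noteq> {} \<and> M \<subseteq> (singular_stratum J k :: (real^'m^'n) set) \<and>
        C1_submanifold (dim (stratum_tangent s :: (real^'m^'n) set)) M"
      using M by blast
    fix d assume "\<exists>N. N \<noteq> {} \<and> N \<subseteq> (singular_stratum J k :: (real^'m^'n) set) \<and> C1_submanifold d N"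
    then obtain N :: "(real^'m^'n) set" where N: "N \<noteq> {}" "N \<subseteq> singular_stratum J k" "C1_submanifold d N"
      by blast
    obtain s' \<sigma>' where s': "inj_on \<sigma>' {1..J}" "mset s' = (\<Sum>j=1..J. replicate_mset (k j) (\<sigma>' j))"
      and d: "d \<le> dim (stratum_tangent s' :: (real^'m^'n) set)"
      by (rule singular_stratum_submanifold_dim_le[OF assms N])
    \<comment> \<open>The lists \<open>s\<close> and \<open>s'\<close> belong to different points,
      but the dimension depends only on \<open>k\<close>.\<close>
    have "real (dim (stratum_tangent s' :: (real^'m^'n) set)) = real (dim (stratum_tangent s :: (real^'m^'n) set))"
      using dim[OF s] dim[OF s'] by simp
    then show "d \<le> dim (stratum_tangent s :: (real^'m^'n) set)"
      using d by simp
  qed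
  then show ?thesis
    using dim[OF s] by simp
qed

end
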